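(* Let $1\le m\le\infty$, let $L=(L,l_i)$ be an $L(m)$-algebra and let $M=(M,k_1)$ be a differential graded vector space. Then there exists a natural one-to-one correspondence between left $L$-module structures on $M$ (with first structure map the given differential $k_1$) and weak $L(m)$-maps $L\to\mathrm{End}(M)_L$.
   Context: All objects are over a fixed field $\mathbf k$ of characteristic zero; graded means $\mathbb Z$-graded; differentials have degree $-1$; the Koszul sign convention is used (commuting things of degrees $p$ and $q$ gives the sign $(-1)^{pq}$). Signs. For homogeneous $x_1,\ldots,x_n$ and $\sigma\in\mathcal S_n$ (symmetric group), the Koszul sign $\epsilon(\sigma;x_1,\ldots,x_n)$ is defined by $x_1\wedge\cdots\wedge x_n=\epsilon(\sigma)\,x_{\sigma(1)}\wedge\cdots\wedge x_{\sigma(n)}$ in the free graded commutative algebra on $x_1,\ldots,x_n$; and $\chi(\sigma)=\chi(\sigma;x_1,\ldots,x_n):=\mathrm{sgn}(\sigma)\,\epsilon(\sigma;x_1,\ldots,x_n)$. A permutation $\sigma\in\mathcal S_n$ is a $(j,n-j)$-unshuffle if $\sigma(1)<\cdots<\sigma(j)$ and $\sigma(j+1)<\cdots<\sigma(n)$. $L(m)$-algebra: a graded vector space $L$ with linear maps $l_k:\bigotimes^kL\to L$, $1\le k\le m$, $k<\infty$, of degree $k-2$, antisymmetric, $l_k(x_{\sigma(1)},\ldots,x_{\sigma(k)})=\chi(\sigma)\,l_k(x_1,\ldots,x_k)$ for $\sigma\in\mathcal S_k$, such that for all finite $n$ with $1\le n\le m$ $$\sum_{i+j=n+1}\sum_\sigma\chi(\sigma)(-1)^{i(j-1)}l_j(l_i(x_{\sigma(1)},\ldots,x_{\sigma(i)}),x_{\sigma(i+1)},\ldots,x_{\sigma(n)})=0,$$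 where $i,j\ge1$ and $\sigma$ runs over all $(i,n-i)$-unshuffles. Left $L$-module structure on a differential graded vector space $(M,k_1)$: a collection of linear maps $k_n:\bigotimes^{n-1}L\otimes M\to M$, $1\le n\le m$, $n<\infty$, of degree $n-2$ (with $k_1$ the differential of $M$), antisymmetric in the $L$-arguments, i.e. $k_n(\xi_{\sigma(1)},\ldots,\xi_{\sigma(n-1)},\xi_n)=\chi(\sigma)\,k_n(\xi_1,\ldots,\xi_n)$ for $\sigma\in\mathcal S_{n-1}$, such that for all finite $n$ with $1\le n\le m$, all $\xi_1,\ldots,\xi_{n-1}\in L$ and $\xi_n\in M$, $$\sum_{i+j=n+1}\sum_\sigma\chi(\sigma)(-1)^{i(j-1)}k_j(k_i(\xi_{\sigma(1)},\ldots,\xi_{\sigma(i)}),\xi_{\sigma(i+1)},\ldots,\xi_{\sigma(n)})=0,$$ where $i,j\ge1$ and $\sigma$ ranges over all $(i,n-i)$-unshuffles. For such $\sigma$ either $\sigma(i)=n$ or $\sigma(n)=n$. If $\sigma(i)=n$ one sets $$k_j(k_i(\xi_{\sigma(1)},\ldots,\xi_{\sigma(i)}),\xi_{\sigma(i+1)},\ldots,\xi_{\sigma(n)}):=\alpha\, k_j(\xi_{\sigma(i+1)},\ldots,\xi_{\sigma(n)},k_i(\xi_{\sigma(1)},\ldots,\xi_{\sigma(i)})),$$ $$\alpha=(-1)^{j-1}(-1)^{(i+\sum_{k=1}^i|\xi_{\sigma(k)}|)(\sum_{k=i+1}^n|\xi_{\sigma(k)}|)};$$ if $\xi_{\sigma(i)}\in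 L$ one takes $k_i=l_i$ for the inner operation. Weak $L(m)$-map from an $L(m)$-algebra $L$ to a differential graded Lie algebra $(A,\partial_A,[-,-])$: a collection of skew symmetric linear maps $f_n:\bigotimes^nL\to A$, $1\le n\le m-1$, $n<\infty$, of degree $n-1$ (skew symmetric: $f_n(\xi_{\sigma(1)},\ldots,\xi_{\sigma(n)})=\chi(\sigma)f_n(\xi_1,\ldots,\xi_n)$), such that for all finite $n$ with $1\le n\le m-1$ and $\xi_1,\ldots,\xi_n\in L$ $$\partial_Af_n(\xi_1,\ldots,\xi_n)+\sum_{j+k=n+1}\sum_\sigma\chi(\sigma)(-1)^{k(j-1)+1}f_j(l_k(\xi_{\sigma(1)},\ldots,\xi_{\sigma(k)}),\xi_{\sigma(k+1)},\ldots,\xi_{\sigma(n)})$$ $$+\sum_{s+t=n}\sum_\tau\chi(\tau)(-1)^{s-1}(-1)^{(t-1)\sum_{p=1}^s|\xi_{\tau(p)}|}[f_s(\xi_{\tau(1)},\ldots,\xi_{\tau(s)}),f_t(\xi_{\tau(s+1)},\ldots,\xi_{\tau(n)})]=0,$$ where $j,k,s,t\ge1$, $\sigma$ runs over all $(k,n-k)$-unshuffles and $\tau$ over all $(s,n-s)$-unshuffles with $\tau(1)<\tau(s+1)$. $\mathrm{End}(M)$ is the graded associative algebra of linear maps $M\to M$ with composition as product and differential $\phi\mapsto k_1\circ\phi-(-1)^{|\phi|}\phi\circ k_1$; $\mathrm{End}(M)_L$ is the associated differential graded Lie algebra with the graded commutator bracket $[\phi,\psi]=\phi\psi-(-1)^{|\phi||\psi|}\psi\phi$.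 *)

theory Defs
  imports
    "HOL-Combinatorics.Permutations"
    "HOL-Library.Extended_Nat"
    "HOL-Library.Function_Algebras"
begin

section \<open>Signs\<close>

text \<open>
  Permutations in \<open>S\<^sub>n\<close> act on the positions \<open>0, \<dots>, n - 1\<close>, so all indices are shifted by one
  with respect to the usual formulas.  The signs depend on homogeneous elements only through their
  degrees; they take a list of degrees as argument.
\<close>

definition psgn :: "int \<Rightarrow> int"
  where "psgn p = (if even p then 1 else -1)"

text \<open>
  \<open>\<epsilon>(\<sigma>)\<close>: every pair of factors that \<open>\<sigma>\<close> puts in the wrong order contributes one
  commutation sign.  See \<open>koszul_sign_prod_list\<close> below for the characterisation of this sign in
  graded commutative algebras.
\<close>

definition koszul_sign :: "(nat \<Rightarrow> nat) \<Rightarrow> int list \<Rightarrow> int"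
  where "koszul_sign \<sigma> ds =
    (\<Prod>(a, b) | a < b \<and> b < length ds \<and> \<sigma> b < \<sigma> a. psgn (ds ! \<sigma> a * ds ! \<sigma> b))"

lemma koszul_sign_prod_list_aux:
  fixes y :: "nat \<Rightarrow> 'a::ring_1"
  assumes "\<And>a b. a \<in> A \<Longrightarrow> b \<in> A \<Longrightarrow> a \<noteq> b \<Longrightarrow> y a * y b = of_int (psgn (ds ! a * ds ! b)) * (y b * y a)"
    and "distinct p" "set p \<subseteq> A"
  shows "prod_list (map y (sort p)) =
    of_int (\<Prod>(a, b) | a < b \<and> b < length p \<and> p ! b < p ! a. psgn (ds ! (p ! a) * ds ! (p ! b)))
      * prod_list (map y p)"
  using assms(2,3)
proof (induction p)
  case Nil
  have "{(a::nat, b::nat). False} = {}" by auto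
  then show ?case by simp
next
  case (Cons x p)
  let ?P = "\<Prod>(a, b) | a < b \<and> b < length p \<and> p ! b < p ! a. psgn (ds ! (p ! a) * ds ! (p ! b))"
  let ?S = "{(a, b). a < b \<and> b < length p \<and> p ! b < p ! a}"
  let ?T = "{b. b < length p \<and> p ! b < x}"
  have comm: "of_int c * (u::'a) = u * of_int c" for c u by (rule mult_of_int_commute)
  have lc: "u * (of_int c * v) = of_int c * (u * v)" for c and u v :: 'a
  proof -
    have "u * (of_int c * v) = (u * of_int c) * v" by (simp only: mult.assoc)
    also have "\<dots> = (of_int c * u) * v" by (simp only: comm[of c u])
    finally show ?thesis by (simp only: mult.assoc)
  qed
  have ins: "prod_list (map y (insort x q)) =
      of_int (\<Prod>b | b \<in> set q \<and> b < x. psgn (ds ! x * ds ! b)) * (y x * prod_list (map y q))"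
    if "sorted q" "distinct q" "x \<notin> set q" "set q \<subseteq> A" for q
    using that
  proof (induction q)
    case Nil then show ?case by simp
  next
    case (Cons b q)
    show ?case
    proof (cases "x \<le> b")
      case True
      then have "{c. c \<in> set (b # q) \<and> c < x} = {}" using Cons.prems by auto
      then have "(\<Prod>c | c \<in> set (b # q) \<and> c < x. psgn (ds ! x * ds ! c)) = 1" by (simp only: prod.empty)
      then show ?thesis using True by (simp del: list.set)
    next
      case False
      have e: "{c. c \<in> set (b # q) \<and> c < x} = insert b {c. c \<in> set q \<and> c < x}" using False by auto
      let ?R = "\<Prod>b | b \<in> set q \<and> b < x. psgn (ds ! x * ds ! b)"
      have R: "(\<Prod>c | c \<in> set (b # q) \<and> c < x. psgn (ds ! x * ds ! c)) = psgn (ds ! x * ds ! b) * ?R"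
        unfolding e using Cons.prems by (subst prod.insert) auto
      have yb: "y b * y x = of_int (psgn (ds ! x * ds ! b)) * (y x * y b)"
        using assms(1)[of b x] Cons.prems \<open>set (x # p) \<subseteq> A\<close> by (auto simp: mult.commute)
      then have "y b * (of_int ?R * (y x * u)) =
          of_int (psgn (ds ! x * ds ! b) * ?R) * (y x * (y b * u))" for u
      proof -
        have "y b * (of_int ?R * (y x * u)) = of_int ?R * ((y b * y x) * u)"
          by (simp only: lc mult.assoc)
        also have "\<dots> = of_int ?R * (of_int (psgn (ds ! x * ds ! b)) * (y x * (y b * u)))"
          unfolding yb by (simp only: mult.assoc)
        also have "\<dots> = of_int (?R * psgn (ds ! x * ds ! b)) * (y x * (y b * u))"
          by (simp only: of_int_mult mult.assoc)
        finally show ?thesis by (simp only: mult.commute[of ?R])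
      qed
      moreover have "prod_list (map y (insort x (b # q))) = y b * (of_int ?R * (y x * prod_list (map y q)))"
        using False Cons by simp
      ultimately show ?thesis unfolding R by simp
    qed
  qed
  have "prod_list (map y (sort (x # p))) =
     of_int (\<Prod>b | b \<in> set p \<and> b < x. psgn (ds ! x * ds ! b)) * (y x * (of_int ?P * prod_list (map y p)))"
    using ins[of "sort p"] Cons by simp
  moreover have "(\<Prod>b | b \<in> set p \<and> b < x. psgn (ds ! x * ds ! b)) = (\<Prod>b\<in>?T. psgn (ds ! x * ds ! (p ! b)))"
    using Cons.prems
    by (intro prod.reindex_bij_betw[symmetric] bij_betwI')
       (auto simp: nth_eq_iff_index_eq in_set_conv_nth)
  moreover have "(\<Prod>(a, b) | a < b \<and> b < length (x#p) \<and> (x#p) ! b < (x#p) ! a. psgn (ds ! ((x#p) ! a) * ds ! ((x#p) ! b)))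
     = (\<Prod>b\<in>?T. psgn (ds ! x * ds ! (p ! b))) * ?P"
  proof -
    have s: "{(a, b). a < b \<and> b < length (x#p) \<and> (x#p) ! b < (x#p) ! a} =
       (\<lambda>b. (0, Suc b)) ` ?T \<union> (\<lambda>(a, b). (Suc a, Suc b)) ` ?S" (is "?U = _")
    proof (intro set_eqI iffI)
      fix z assume "z \<in> ?U"
      then obtain a b where z: "z = (a, b)" "a < b" "b < length (x#p)" "(x#p) ! b < (x#p) ! a" by auto
      then obtain b' where b': "b = Suc b'" by (cases b) auto
      show "z \<in> (\<lambda>b. (0, Suc b)) ` ?T \<union> (\<lambda>(a, b). (Suc a, Suc b)) ` ?S"
        using z b' by (cases a) (auto simp: image_iff)
    qed auto
    have "finite ?S" by (rule finite_subset[of _ "{..<length p} \<times> {..<length p}"]) auto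
    then show ?thesis unfolding s
      by (subst prod.union_disjoint)
         (auto simp: prod.reindex inj_on_def case_prod_unfold intro!: arg_cong2[where f="(*)"])
  qed
  ultimately show ?case by (simp only: list.map prod_list.Cons of_int_mult mult.assoc lc[of "y x"])
qed

text \<open>
  If \<open>y\<^sub>0, \<dots>, y\<^bsub>n-1\<^esub>\<close> are elements of the given degrees that commute in the graded sense, then
  \<open>y\<^sub>0 \<cdots> y\<^bsub>n-1\<^esub> = \<epsilon>(\<sigma>) y\<^bsub>\<sigma>(0)\<^esub> \<cdots> y\<^bsub>\<sigma>(n-1)\<^esub>\<close>.
\<close>

lemma koszul_sign_prod_list:
  fixes y :: "nat \<Rightarrow> 'a::ring_1"
  assumes "\<And>a b. a < length ds \<Longrightarrow> b < length ds \<Longrightarrow> a \<noteq> b \<Longrightarrow>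
      y a * y b = of_int (psgn (ds ! a * ds ! b)) * (y b * y a)"
    and \<sigma>: "\<sigma> permutes {..<length ds}"
  shows "prod_list (map y [0..<length ds]) =
    of_int (koszul_sign \<sigma> ds) * prod_list (map (\<lambda>r. y (\<sigma> r)) [0..<length ds])"
proof -
  let ?p = "map \<sigma> [0..<length ds]"
  have d: "distinct ?p" using permutes_inj_on[OF \<sigma>] by (simp add: distinct_map)
  have s: "set ?p = {..<length ds}" using permutes_image[OF \<sigma>] by (simp add: atLeast0LessThan)
  have so: "sort ?p = [0..<length ds]"
    using d s by (intro sorted_distinct_set_unique) auto
  have "(\<Prod>(a, b) | a < b \<and> b < length ?p \<and> ?p ! b < ?p ! a. psgn (ds ! (?p ! a) * ds ! (?p ! b)))
     = koszul_sign \<sigma> ds"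
    unfolding koszul_sign_def by (rule prod.cong) auto
  moreover have "prod_list (map y (sort ?p)) =
     of_int (\<Prod>(a, b) | a < b \<and> b < length ?p \<and> ?p ! b < ?p ! a. psgn (ds ! (?p ! a) * ds ! (?p ! b)))
      * prod_list (map y ?p)"
    by (rule koszul_sign_prod_list_aux[of "{..<length ds}"]) (rule assms(1), use d s in auto)
  ultimately show ?thesis unfolding so by (simp only: map_map comp_def)
qed

definition chi :: "(nat \<Rightarrow> nat) \<Rightarrow> int list \<Rightarrow> int"
  where "chi \<sigma> ds = sign \<sigma> * koszul_sign \<sigma> ds"

definition unshuffles :: "nat \<Rightarrow> nat \<Rightarrow> (nat \<Rightarrow> nat) set"
  where "unshuffles j n =
    {\<sigma>. \<sigma> permutes {..<n} \<and> strict_mono_on {..<j} \<sigma> \<and> strict_mono_on {j..<n} \<sigma>}"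

text \<open>The list \<open>x\<^bsub>\<sigma>(a)\<^esub>, \<dots>, x\<^bsub>\<sigma>(b-1)\<^esub>\<close> for \<open>xs = [x\<^sub>0, x\<^sub>1, \<dots>]\<close>.\<close>

definition args :: "(nat \<Rightarrow> nat) \<Rightarrow> nat \<Rightarrow> nat \<Rightarrow> 'a list \<Rightarrow> 'a list"
  where "args \<sigma> a b xs = map (\<lambda>r. xs ! \<sigma> r) [a..<b]"


section \<open>Graded vector spaces and multilinear maps\<close>

text \<open>
  The underlying space of the graded space is the span of the \<open>G p\<close>; it need not be the whole type
  (this is needed for endomorphisms, which form a proper subset of a function type).
\<close>

locale graded_subspaces = vector_space scale
  for scale :: "'k::field_char_0 \<Rightarrow> 'v::ab_group_add \<Rightarrow> 'v" +
  fixes G :: "int \<Rightarrow> 'v set"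
  assumes subspace_G: "subspace (G p)"
    and direct: "\<lbrakk>finite I; \<And>p. p \<in> I \<Longrightarrow> x p \<in> G p; (\<Sum>p\<in>I. x p) = 0; q \<in> I\<rbrakk> \<Longrightarrow> x q = 0"

locale graded_vector_space = graded_subspaces +
  assumes span_G: "span (\<Union>p. G p) = UNIV"

locale dg_vector_space = graded_vector_space scale G
  for scale :: "'k::field_char_0 \<Rightarrow> 'v::ab_group_add \<Rightarrow> 'v" and G +
  fixes d :: "'v \<Rightarrow> 'v"
  assumes d_linear: "Vector_Spaces.linear scale scale d"
    and d_degree: "x \<in> G p \<Longrightarrow> d x \<in> G (p - 1)"
    and d_d: "d (d x) = 0"

text \<open>
  A family of operations, one on each tensor power, is represented by a single function on lists;
  the \<open>n\<close>-th operation is its restriction to lists of length \<open>n\<close>.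
\<close>

definition multilinear ::
    "('k::field \<Rightarrow> 'v::ab_group_add \<Rightarrow> 'v) \<Rightarrow> ('k \<Rightarrow> 'w::ab_group_add \<Rightarrow> 'w) \<Rightarrow>
     nat \<Rightarrow> ('v list \<Rightarrow> 'w) \<Rightarrow> bool"
  where "multilinear s1 s2 n f \<longleftrightarrow>
    (\<forall>xs i. length xs = n \<longrightarrow> i < n \<longrightarrow> Vector_Spaces.linear s1 s2 (\<lambda>x. f (xs[i := x])))"

definition homogeneous :: "(int \<Rightarrow> 'v set) \<Rightarrow> int list \<Rightarrow> 'v list \<Rightarrow> bool"
  where "homogeneous G ds xs \<longleftrightarrow> list_all2 (\<lambda>p x. x \<in> G p) ds xs"


section \<open>\<open>L(m)\<close>-algebras and their modules\<close>

locale Lm_algebra = graded_vector_space scale G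
  for scale :: "'k::field_char_0 \<Rightarrow> 'l::ab_group_add \<Rightarrow> 'l" and G +
  fixes m :: enat and l :: "'l list \<Rightarrow> 'l"
  assumes l_multilinear: "\<lbrakk>1 \<le> n; enat n \<le> m\<rbrakk> \<Longrightarrow> multilinear scale scale n l"
    and l_degree: "\<lbrakk>1 \<le> length xs; enat (length xs) \<le> m; homogeneous G ds xs\<rbrakk>
      \<Longrightarrow> l xs \<in> G (sum_list ds + int (length xs) - 2)"
    and l_skew: "\<lbrakk>1 \<le> length xs; enat (length xs) \<le> m; homogeneous G ds xs;
        \<sigma> permutes {..<length xs}\<rbrakk>
      \<Longrightarrow> l (permute_list \<sigma> xs) = scale (of_int (chi \<sigma> ds)) (l xs)"
    and l_relation: "\<lbrakk>1 \<le> n; enat n \<le> m; length xs = n; homogeneous G ds xs\<rbrakk> \<Longrightarrow>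
      (\<Sum>(i, j) | 1 \<le> i \<and> 1 \<le> j \<and> i + j = n + 1. \<Sum>\<sigma>\<in>unshuffles i n.
        scale (of_int (chi \<sigma> ds * (-1) ^ (i * (j - 1))))
          (l (l (args \<sigma> 0 i xs) # args \<sigma> i n xs))) = 0"

text \<open>
  The summand of the module relation belonging to \<open>i\<close>, \<open>j\<close> and the unshuffle \<open>\<sigma>\<close>, without the factor
  \<open>\<chi>(\<sigma>)(-1)\<^bsup>i(j-1)\<^esup>\<close>.  Here \<open>n = i + j - 1\<close>, the elements of \<open>L\<close> are \<open>xs\<close> (of length \<open>n - 1\<close>),
  the last argument, at position \<open>n - 1\<close>, is \<open>v\<close>, and \<open>ds\<close> (of length \<open>n\<close>) lists all degrees.
  The value \<open>k\<^sub>n(\<xi>\<^sub>1, \<dots>, \<xi>\<^sub>n)\<close> is written \<open>k [\<xi>\<^sub>1, \<dots>, \<xi>\<^bsub>n-1\<^esub>] \<xi>\<^sub>n\<close>.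
\<close>

definition module_term ::
    "('k::field \<Rightarrow> 'v::ab_group_add \<Rightarrow> 'v) \<Rightarrow> ('l list \<Rightarrow> 'l) \<Rightarrow> ('l list \<Rightarrow> 'v \<Rightarrow> 'v) \<Rightarrow>
     nat \<Rightarrow> nat \<Rightarrow> (nat \<Rightarrow> nat) \<Rightarrow> int list \<Rightarrow> 'l list \<Rightarrow> 'v \<Rightarrow> 'v"
  where "module_term scaleM l k i j \<sigma> ds xs v =
    (let n = i + j - 1;
         \<alpha> = (-1) ^ (j - 1) *
           psgn ((int i + sum_list (args \<sigma> 0 i ds)) * sum_list (args \<sigma> i n ds))
     in if \<sigma> (i - 1) = n - 1
        then scaleM (of_int \<alpha>) (k (args \<sigma> i n xs) (k (args \<sigma> 0 (i - 1) xs) v))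
        else k (l (args \<sigma> 0 i xs) # args \<sigma> i (n - 1) xs) v)"

text \<open>The value of \<open>k\<close> outside the relevant arities is fixed to be \<open>0\<close>, so that \<open>k\<close> is the same
  thing as the collection of its structure maps.\<close>

locale left_module =
  L: Lm_algebra scaleL GL m l + M: dg_vector_space scaleM GM k1
  for scaleL :: "'k::field_char_0 \<Rightarrow> 'l::ab_group_add \<Rightarrow> 'l" and GL m l
    and scaleM :: "'k \<Rightarrow> 'v::ab_group_add \<Rightarrow> 'v" and GM k1 +
  fixes k :: "'l list \<Rightarrow> 'v \<Rightarrow> 'v"
  assumes k_Nil: "k [] = k1"
    and k_multilinear: "\<lbrakk>1 \<le> n; enat n \<le> m\<rbrakk> \<Longrightarrow> multilinear scaleL scaleM (n - 1) (\<lambda>xs. k xs v)"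
    and k_linear: "\<lbrakk>1 \<le> n; enat n \<le> m; length xs = n - 1\<rbrakk>
      \<Longrightarrow> Vector_Spaces.linear scaleM scaleM (k xs)"
    and k_degree: "\<lbrakk>1 \<le> n; enat n \<le> m; length xs = n - 1; homogeneous GL ds xs; v \<in> GM q\<rbrakk>
      \<Longrightarrow> k xs v \<in> GM (sum_list ds + q + int n - 2)"
    and k_skew: "\<lbrakk>1 \<le> n; enat n \<le> m; length xs = n - 1; homogeneous GL ds xs; 
        \<sigma> permutes {..<n - 1}\<rbrakk>
      \<Longrightarrow> k (permute_list \<sigma> xs) v = scaleM (of_int (chi \<sigma> ds)) (k xs v)"
    and k_relation: "\<lbrakk>1 \<le> n; enat n \<le> m; length xs = n - 1; homogeneous GL ds xs; v \<in> GM q\<rbrakk> \<Longrightarrow>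
      (\<Sum>(i, j) | 1 \<le> i \<and> 1 \<le> j \<and> i + j = n + 1. \<Sum>\<sigma>\<in>unshuffles i n.
        scaleM (of_int (chi \<sigma> (ds @ [q]) * (-1) ^ (i * (j - 1))))
          (module_term scaleM l k i j \<sigma> (ds @ [q]) xs v)) = 0"
    and k_outside: "\<not> enat (length xs + 1) \<le> m \<Longrightarrow> k xs = 0"


section \<open>Differential graded Lie algebras and weak maps\<close>

text \<open>
  \<open>d p\<close> is the component \<open>A\<^sub>p \<rightarrow> A\<^bsub>p-1\<^esub>\<close> of the differential and \<open>br p q\<close> the component
  \<open>A\<^sub>p \<times> A\<^sub>q \<rightarrow> A\<^bsub>p+q\<^esub>\<close> of the bracket.
\<close>

locale dg_lie_algebra = graded_subspaces scale A
  for scale :: "'k::field_char_0 \<Rightarrow> 'a::ab_group_add \<Rightarrow> 'a" and A +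
  fixes d :: "int \<Rightarrow> 'a \<Rightarrow> 'a" and br :: "int \<Rightarrow> int \<Rightarrow> 'a \<Rightarrow> 'a \<Rightarrow> 'a"
  assumes d_degree: "x \<in> A p \<Longrightarrow> d p x \<in> A (p - 1)"
    and d_add: "\<lbrakk>x \<in> A p; y \<in> A p\<rbrakk> \<Longrightarrow> d p (x + y) = d p x + d p y"
    and d_scale: "x \<in> A p \<Longrightarrow> d p (scale c x) = scale c (d p x)"
    and d_d: "x \<in> A p \<Longrightarrow> d (p - 1) (d p x) = 0"
    and br_degree: "\<lbrakk>x \<in> A p; y \<in> A q\<rbrakk> \<Longrightarrow> br p q x y \<in> A (p + q)"
    and br_add: "\<lbrakk>x \<in> A p; x' \<in> A p; y \<in> A q\<rbrakk> \<Longrightarrow> br p q (x + x') y = br p q x y + br p q x' y"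
    and br_scale: "\<lbrakk>x \<in> A p; y \<in> A q\<rbrakk> \<Longrightarrow> br p q (scale c x) y = scale c (br p q x y)"
    and br_skew: "\<lbrakk>x \<in> A p; y \<in> A q\<rbrakk>
      \<Longrightarrow> br p q x y = - scale (of_int (psgn (p * q))) (br q p y x)"
    and br_jacobi: "\<lbrakk>x \<in> A p; y \<in> A q; z \<in> A r\<rbrakk> \<Longrightarrow>
      br p (q + r) x (br q r y z) = br (p + q) r (br p q x y) z +
        scale (of_int (psgn (p * q))) (br q (p + r) y (br p r x z))"
    and br_leibniz: "\<lbrakk>x \<in> A p; y \<in> A q\<rbrakk> \<Longrightarrow>
      d (p + q) (br p q x y) = br (p - 1) q (d p x) y +
        scale (of_int (psgn p)) (br p (q - 1) x (d q y))"

text \<open>The value of \<open>f\<close> outside the arities \<open>1 \<le> n \<le> m - 1\<close> is fixed to be \<open>0\<close>.\<close>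

locale weak_Lm_map =
  L: Lm_algebra scaleL GL m l + A: dg_lie_algebra scaleA A d br
  for scaleL :: "'k::field_char_0 \<Rightarrow> 'l::ab_group_add \<Rightarrow> 'l" and GL m l
    and scaleA :: "'k \<Rightarrow> 'a::ab_group_add \<Rightarrow> 'a" and A d br +
  fixes f :: "'l list \<Rightarrow> 'a"
  assumes f_multilinear: "\<lbrakk>1 \<le> n; enat n \<le> m - 1\<rbrakk> \<Longrightarrow> multilinear scaleL scaleA n f"
    and f_degree: "\<lbrakk>1 \<le> length xs; enat (length xs) \<le> m - 1; homogeneous GL ds xs\<rbrakk>
      \<Longrightarrow> f xs \<in> A (sum_list ds + int (length xs) - 1)"
    and f_skew: "\<lbrakk>1 \<le> length xs; enat (length xs) \<le> m - 1; homogeneous GL ds xs;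
        \<sigma> permutes {..<length xs}\<rbrakk>
      \<Longrightarrow> f (permute_list \<sigma> xs) = scaleA (of_int (chi \<sigma> ds)) (f xs)"
    and f_relation: "\<lbrakk>1 \<le> n; enat n \<le> m - 1; length xs = n; homogeneous GL ds xs\<rbrakk> \<Longrightarrow>
      d (sum_list ds + int n - 1) (f xs)
      + (\<Sum>(j, k) | 1 \<le> j \<and> 1 \<le> k \<and> j + k = n + 1. \<Sum>\<sigma>\<in>unshuffles k n.
          scaleA (of_int (chi \<sigma> ds * (-1) ^ (k * (j - 1) + 1)))
            (f (l (args \<sigma> 0 k xs) # args \<sigma> k n xs)))
      + (\<Sum>(s, t) | 1 \<le> s \<and> 1 \<le> t \<and> s + t = n. \<Sum>\<tau>\<in>{\<tau> \<in> unshuffles s n. \<tau> 0 < \<tau> s}.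
          scaleA (of_int (chi \<tau> ds * (-1) ^ (s - 1) *
              psgn ((int t - 1) * sum_list (args \<tau> 0 s ds))))
            (br (sum_list (args \<tau> 0 s ds) + int s - 1) (sum_list (args \<tau> s n ds) + int t - 1)
              (f (args \<tau> 0 s xs)) (f (args \<tau> s n xs)))) = 0"
    and f_outside: "\<not> (1 \<le> length xs \<and> enat (length xs) \<le> m - 1) \<Longrightarrow> f xs = 0"


section \<open>The differential graded Lie algebra \<open>End(M)\<^sub>L\<close>\<close>

definition End_scale :: "('k \<Rightarrow> 'v \<Rightarrow> 'v) \<Rightarrow> 'k \<Rightarrow> ('v \<Rightarrow> 'v) \<Rightarrow> 'v \<Rightarrow> 'v"
  where "End_scale scale c \<phi> = (\<lambda>v. scale c (\<phi> v))"

definition End_grading ::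
    "('k::field \<Rightarrow> 'v::ab_group_add \<Rightarrow> 'v) \<Rightarrow> (int \<Rightarrow> 'v set) \<Rightarrow> int \<Rightarrow> ('v \<Rightarrow> 'v) set"
  where "End_grading scale G p =
    {\<phi>. Vector_Spaces.linear scale scale \<phi> \<and> (\<forall>q. \<forall>v\<in>G q. \<phi> v \<in> G (p + q))}"

definition End_diff ::
    "('k::field \<Rightarrow> 'v::ab_group_add \<Rightarrow> 'v) \<Rightarrow> ('v \<Rightarrow> 'v) \<Rightarrow> int \<Rightarrow> ('v \<Rightarrow> 'v) \<Rightarrow> 'v \<Rightarrow> 'v"
  where "End_diff scale k1 p \<phi> = (k1 \<circ> \<phi>) - End_scale scale (of_int (psgn p)) (\<phi> \<circ> k1)"

definition End_bracket ::
    "('k::field \<Rightarrow> 'v::ab_group_add \<Rightarrow> 'v) \<Rightarrow> int \<Rightarrow> int \<Rightarrow> ('v \<Rightarrow> 'v) \<Rightarrow> ('v \<Rightarrow> 'v) \<Rightarrow> 'v \<Rightarrow> 'v"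
  where "End_bracket scale p q \<phi> \<psi> = (\<phi> \<circ> \<psi>) - End_scale scale (of_int (psgn (p * q))) (\<psi> \<circ> \<phi>)"

lemma End_vector_space:
  assumes "vector_space s" shows "vector_space (End_scale s)"
proof -
  interpret vector_space s by fact
  show ?thesis by unfold_locales (auto simp: End_scale_def fun_eq_iff algebra_simps)
qed

lemma dg_lie_algebra_End:
  assumes "dg_vector_space s G k1"
  shows "dg_lie_algebra (End_scale s) (End_grading s G) (End_diff s k1) (End_bracket s)"
proof -
  interpret dg_vector_space s G k1 by fact
  interpret E: vector_space "End_scale s" by (rule End_vector_space) unfold_locales
  interpret vector_space_pair s s ..
  note lin = linear_add linear_scale linear_diff linear_neg linear_0
  have Ed: "\<phi> v \<in> G (p + q)" if "\<phi> \<in> End_grading s G p" "v \<in> G q" for \<phi> p v q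
    using that by (auto simp: End_grading_def)
  have El: "Vector_Spaces.linear s s \<phi>" if "\<phi> \<in> End_grading s G p" for \<phi> p
    using that by (auto simp: End_grading_def)
  have comp: "\<phi> \<circ> \<psi> \<in> End_grading s G (p + q)"
    if "\<phi> \<in> End_grading s G p" "\<psi> \<in> End_grading s G q" for \<phi> \<psi> p q
    using that by (auto simp: End_grading_def add.assoc intro: Vector_Spaces.linear_compose)
  have sub: "E.subspace (End_grading s G p)" for p
    unfolding E.subspace_def
    by (auto simp: End_grading_def End_scale_def zero_fun_def plus_fun_def
        linear_zero linear_compose_add linear_compose_scale_right
        subspace_0[OF subspace_G] subspace_add[OF subspace_G] subspace_scale[OF subspace_G])
  have k1: "k1 \<in> End_grading s G (-1)" using d_linear d_degree by (auto simp: End_grading_def)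
  have k1k1: "k1 \<circ> k1 = 0" using d_d by auto
  have sgnE: "End_scale s (of_int (psgn p)) \<phi> = (if even p then \<phi> else - \<phi>)" for p \<phi>
    by (auto simp: psgn_def End_scale_def)
  have rcomp: "(\<phi> + \<psi>) \<circ> \<chi> = (\<phi> \<circ> \<chi>) + (\<psi> \<circ> \<chi>)" "(\<phi> - \<psi>) \<circ> \<chi> = (\<phi> \<circ> \<chi>) - (\<psi> \<circ> \<chi>)"
     "(- \<phi>) \<circ> \<chi> = - (\<phi> \<circ> \<chi>)" "End_scale s c \<phi> \<circ> \<chi> = End_scale s c (\<phi> \<circ> \<chi>)"
    for \<phi> \<psi> \<chi> :: "'b \<Rightarrow> 'b" and c by (auto simp: End_scale_def fun_eq_iff)
  have lcomp: "\<chi> \<circ> (\<phi> + \<psi>) = (\<chi> \<circ> \<phi>) + (\<chi> \<circ> \<psi>)" "\<chi> \<circ> (\<phi> - \<psi>) = (\<chi> \<circ> \<phi>) - (\<chi> \<circ> \<psi>)"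
     "\<chi> \<circ> (- \<phi>) = - (\<chi> \<circ> \<phi>)" "\<chi> \<circ> End_scale s c \<phi> = End_scale s c (\<chi> \<circ> \<phi>)"
    if "\<chi> \<in> End_grading s G p" for \<phi> \<psi> \<chi> p c using El[OF that]
    by (auto simp: End_scale_def lin fun_eq_iff)
  have "graded_subspaces (End_scale s) (End_grading s G)"
  proof unfold_locales
    show "E.subspace (End_grading s G p)" for p by (rule sub)
    fix I x q assume I: "finite I" "\<And>p. p \<in> I \<Longrightarrow> x p \<in> End_grading s G p" "(\<Sum>p\<in>I. x p) = 0" "q \<in> I"
    have ev: "(\<Sum>p\<in>J. x p) v = (\<Sum>p\<in>J. x p v)" if "finite J" for J v using that by induction auto
    have z: "x q v = 0" if v: "v \<in> G r" for v r
    proof -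
      have "(\<Sum>p\<in>(\<lambda>p. p + r) ` I. x (p - r) v) = 0"
        using I(3) ev[OF I(1), of v] by (subst sum.reindex) auto
      then have "x (q + r - r) v = 0"
        using I Ed[OF _ v] by (intro direct[of "(\<lambda>p. p + r) ` I" "\<lambda>p. x (p - r) v"]) auto
      then show ?thesis by simp
    qed
    have "x q v = 0" for v
      
      by (rule linear_eq_0_on_span[OF El[OF I(2)[OF I(4)]], where b="\<Union>p. G p"]) (use z span_G in auto)
    then show "x q = 0" by auto
  qed
  moreover have "dg_lie_algebra_axioms (End_scale s) (End_grading s G) (End_diff s k1) (End_bracket s)"
  proof
    fix x y z x' p q r c
    note [simp] = rcomp lcomp[OF k1] sgnE 
    show "End_diff s k1 p x \<in> End_grading s G (p - 1)" if "x \<in> End_grading s G p"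
      using comp[OF k1 that] comp[OF that k1] unfolding End_diff_def
      by (intro E.subspace_diff[OF sub] E.subspace_scale[OF sub]) auto
    show "End_diff s k1 p (x + y) = End_diff s k1 p x + End_diff s k1 p y"
      by (auto simp: End_diff_def E.scale_right_distrib)
    show "End_diff s k1 p (End_scale s c x) = End_scale s c (End_diff s k1 p x)"
      by (auto simp: End_diff_def psgn_def E.scale_right_diff_distrib E.scale_right_distrib)
    show "End_diff s k1 (p - 1) (End_diff s k1 p x) = 0" if "x \<in> End_grading s G p"
      using El[OF that] by (auto simp: End_diff_def comp_assoc lin lin[OF d_linear] fun_eq_iff d_d)
    show "End_bracket s p q x y \<in> End_grading s G (p + q)"
      if "x \<in> End_grading s G p" "y \<in> End_grading s G q"
      using comp[OF that] comp[OF that(2,1)] unfolding End_bracket_def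
      by (intro E.subspace_diff[OF sub] E.subspace_scale[OF sub]) (auto simp: add.commute)
    show "End_bracket s p q (x + x') y = End_bracket s p q x y + End_bracket s p q x' y" 
      if "y \<in> End_grading s G q"
      using lcomp[OF that] by (auto simp: End_bracket_def)
    show "End_bracket s p q (End_scale s c x) y = End_scale s c (End_bracket s p q x y)"
      if "y \<in> End_grading s G q"
      using lcomp[OF that] by (auto simp: End_bracket_def psgn_def E.scale_right_diff_distrib E.scale_right_distrib)
    show "End_bracket s p q x y = - End_scale s (of_int (psgn (p * q))) (End_bracket s q p y x)"
      by (auto simp: End_bracket_def mult.commute)
    show "End_bracket s p (q + r) x (End_bracket s q r y z) = End_bracket s (p + q) r (End_bracket s p q x y) z +
        End_scale s (of_int (psgn (p * q))) (End_bracket s q (p + r) y (End_bracket s p r x z))"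
      if "x \<in> End_grading s G p" "y \<in> End_grading s G q" "z \<in> End_grading s G r"
      by (auto simp: End_bracket_def comp_assoc lcomp[OF that(1)] lcomp[OF that(2)] lcomp[OF that(3)]; simp add: algebra_simps)
    show "End_diff s k1 (p + q) (End_bracket s p q x y) = End_bracket s (p - 1) q (End_diff s k1 p x) y +
        End_scale s (of_int (psgn p)) (End_bracket s p (q - 1) x (End_diff s k1 q y))"
      if "x \<in> End_grading s G p" "y \<in> End_grading s G q"
      by (auto simp: End_bracket_def End_diff_def comp_assoc lcomp[OF that(1)] lcomp[OF that(2)]; simp add: algebra_simps)
  qed
  ultimately show ?thesis by (rule dg_lie_algebra.intro)
qed

abbreviation weak_Lm_map_to_End
  where "weak_Lm_map_to_End scaleL GL m l scaleM GM k1 \<equiv>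
    weak_Lm_map scaleL GL m l
      (End_scale scaleM) (End_grading scaleM GM) (End_diff scaleM k1) (End_bracket scaleM)"

end

theory Submission
  imports Defs
begin

text \<open>
  Put \<open>f\<^sub>n(\<xi>\<^sub>1, \<dots>, \<xi>\<^sub>n) = (-1)\<^bsup>n-1\<^esup> k\<^bsub>n+1\<^esub>(\<xi>\<^sub>1, \<dots>, \<xi>\<^sub>n, -)\<close>.  In the module relation of arity \<open>n + 1\<close> the
  unshuffles fixing the last position give the terms \<open>f(l(\<dots>), \<dots>)\<close> of the relation for \<open>f\<^sub>n\<close>.  In the
  others the inner operation acts on the module element; removing that element leaves an
  \<open>(s, n-s)\<close>-unshuffle and a composite of two operators \<open>k\<close>, in which the degree of the module
  element cancels from the sign.  The cases \<open>s = 0, n\<close> make up the differential of \<open>f\<^sub>n\<close>.  For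
  \<open>0 < s < n\<close>, interchanging the two blocks pairs the unshuffles with \<open>\<tau>(1) < \<tau>(s+1)\<close> with the
  remaining ones, and each pair is a graded commutator.  Hence both relations agree up to the sign
  \<open>(-1)\<^bsup>n+1\<^esup>\<close>.
\<close>

section \<open>Signs and unshuffles\<close>

lemma psgn_add: "psgn (a + b) = psgn a * psgn b"
  by (auto simp: psgn_def)

lemma power_minus_one_psgn: "(-1) ^ n = psgn (int n)"
  by (auto simp: psgn_def minus_one_power_iff)

lemma psgn_cong: "even a = even b \<Longrightarrow> psgn a = psgn b"
  by (simp add: psgn_def)

text \<open>Only the pair of positions \<open>(i, Suc i)\<close> changes its inversion status; the
  transposition permutes the other pairs together with their factors. As the commutation sign
  squares to 1, gaining and losing the inversion both multiply by it.\<close>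

lemma koszul_sign_transpose_Suc:
  assumes "\<sigma> permutes {..<length ds}" "Suc i < length ds"
  shows "koszul_sign (\<sigma> \<circ> transpose i (Suc i)) ds =
    koszul_sign \<sigma> ds * psgn (ds ! \<sigma> i * ds ! \<sigma> (Suc i))"
proof -
  let ?t = "transpose i (Suc i)"
  define P where "P = {(a, b). a < b \<and> b < length ds}"
  define P' where "P' = P - {(i, Suc i)}"
  \<comment> \<open>Pairs in the right order get the factor 1, so that the products for
    \<open>\<sigma>\<close> and for its composite with \<open>?t\<close> range over the same set
    \<open>P\<close>.\<close>
  define g where "g \<rho> = (\<lambda>(a, b). if \<rho> b < \<rho> a then psgn (ds ! \<rho> a * ds ! \<rho> b) else 1)"
    for \<rho> :: "nat \<Rightarrow> nat"
  have fin: "finite P"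
    by (rule finite_subset[of _ "{..<length ds} \<times> {..<length ds}"]) (auto simp: P_def)
  have K: "koszul_sign \<rho> ds = prod (g \<rho>) P" for \<rho>
  proof -
    have "prod (g \<rho>) P = (\<Prod>z | z \<in> P \<and> (case z of (a, b) \<Rightarrow> \<rho> b < \<rho> a).
        case z of (a, b) \<Rightarrow> psgn (ds ! \<rho> a * ds ! \<rho> b))"
      unfolding g_def using fin by (simp add: prod.inter_filter case_prod_unfold)
    then show ?thesis
      unfolding koszul_sign_def P_def by (simp add: case_prod_unfold conj_assoc)
  qed
  have P: "P = insert (i, Suc i) P'" "(i, Suc i) \<notin> P'" "finite P'"
    using assms(2) fin by (auto simp: P'_def P_def)
  define h where "h = map_prod ?t ?t"
  \<comment> \<open>Exchanging two neighbouring positions reverses no other pair, so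
    \<open>h\<close> is an involution of \<open>P'\<close>.\<close>
  have t: "h z \<in> P'" if "z \<in> P'" for z
  proof -
    from that obtain a b where z: "z = (a, b)" "a < b" "b < length ds" "\<not> (a = i \<and> b = Suc i)"
      by (auto simp: P'_def P_def)
    then have "?t a < ?t b" "?t b < length ds" "\<not> (?t a = i \<and> ?t b = Suc i)"
      using assms(2) by (auto simp: transpose_def split: if_splits)
    then show ?thesis
      by (simp add: z(1) P'_def P_def h_def)
  qed
  have "prod (g (\<sigma> \<circ> ?t)) P' = prod (g \<sigma>) P'"
    by (rule prod.reindex_bij_witness[where i = h and j = h])
      (simp_all add: t, auto simp: h_def g_def)
  moreover have "g (\<sigma> \<circ> ?t) (i, Suc i) = g \<sigma> (i, Suc i) * psgn (ds ! \<sigma> i * ds ! \<sigma> (Suc i))"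
    using inj_eq[OF permutes_inj[OF assms(1)], of i "Suc i"]
    by (auto simp: g_def psgn_def mult.commute)
  ultimately show ?thesis
    unfolding K P(1) using P(2,3) by simp
qed

lemma chi_transpose_Suc:
  assumes "\<sigma> permutes {..<length ds}" "Suc i < length ds"
  shows "chi (\<sigma> \<circ> transpose i (Suc i)) ds = - chi \<sigma> ds * psgn (ds ! \<sigma> i * ds ! \<sigma> (Suc i))"
proof -
  have "permutation \<sigma>" using assms(1) permutation_permutes by blast
  then have "sign (\<sigma> \<circ> transpose i (Suc i)) = - sign \<sigma>"
    by (simp add: sign_compose permutation_swap_id sign_swap_id)
  then show ?thesis by (simp add: chi_def koszul_sign_transpose_Suc[OF assms])
qed

text \<open>The last position is fixed and carries the largest value, so it takes part in no
  inversion and \<open>q\<close> enters no factor.\<close>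

lemma chi_append:
  assumes "\<sigma> permutes {..<length ds}"
  shows "chi \<sigma> (ds @ [q]) = chi \<sigma> ds"
proof -
  have lt: "\<sigma> a < length ds" if "a < length ds" for a
    using permutes_in_image[OF assms, of a] that by simp
  have n: "\<sigma> (length ds) = length ds"
    using permutes_not_in[OF assms] by simp
  have iff: "b < Suc (length ds) \<and> \<sigma> b < \<sigma> a \<longleftrightarrow> b < length ds \<and> \<sigma> b < \<sigma> a" if "a < b" for a b
    using lt[of a] n that by (cases "b = length ds") auto
  have "koszul_sign \<sigma> (ds @ [q]) = koszul_sign \<sigma> ds"
    unfolding koszul_sign_def
  proof (rule prod.cong)
    show "{(a, b). a < b \<and> b < length (ds @ [q]) \<and> \<sigma> b < \<sigma> a} =
        {(a, b). a < b \<and> b < length ds \<and> \<sigma> b < \<sigma> a}"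
      using iff by (simp cong: conj_cong)
    fix z assume "z \<in> {(a, b). a < b \<and> b < length ds \<and> \<sigma> b < \<sigma> a}"
    then obtain a b where z: "z = (a, b)" "a < length ds" "b < length ds" by auto
    then show "(case z of (a, b) \<Rightarrow> psgn ((ds @ [q]) ! \<sigma> a * (ds @ [q]) ! \<sigma> b)) =
        (case z of (a, b) \<Rightarrow> psgn (ds ! \<sigma> a * ds ! \<sigma> b))"
      using lt[of a] lt[of b] by (simp add: nth_append)
  qed
  then show ?thesis by (simp add: chi_def)
qed

text \<open>
  \<open>\<sigma> \<circ> block_swap a s t\<close> lists the values of \<open>\<sigma>\<close> with the block of length \<open>s\<close> starting at position \<open>a\<close>
  and the block of length \<open>t\<close> that follows it interchanged.
\<close>

definition block_swap :: "nat \<Rightarrow> nat \<Rightarrow> nat \<Rightarrow> nat \<Rightarrow> nat"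
  where "block_swap a s t r =
    (if a \<le> r \<and> r < a + t then r + s else if a + t \<le> r \<and> r < a + t + s then r - t else r)"

lemma block_swap_block_swap [simp]: "block_swap a s t (block_swap a t s r) = r"
  by (auto simp: block_swap_def)

lemma block_swap_comp [simp]: "block_swap a s t \<circ> block_swap a t s = id"
  by auto

lemma permutes_block_swap:
  assumes "a + s + t \<le> n"
  shows "block_swap a s t permutes {..<n}"
proof (rule bij_imp_permutes)
  show "bij_betw (block_swap a s t) {..<n} {..<n}"
    by (rule bij_betw_byWitness[where f' = "block_swap a t s"])
       (use assms in \<open>auto simp: block_swap_def\<close>)
qed (use assms in \<open>auto simp: block_swap_def\<close>)

text \<open>One entry is carried leftwards across \<open>s\<close> entries by adjacent
  transpositions; each contributes -1 and one commutation sign, and the exponents of the latter add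
  up.\<close>

lemma chi_block_swap_one:
  assumes "\<sigma> permutes {..<length ds}" "a + s < length ds"
  shows "chi (\<sigma> \<circ> block_swap a s 1) ds =
    chi \<sigma> ds * (-1) ^ s * psgn ((\<Sum>r=a..<a + s. ds ! \<sigma> r) * ds ! \<sigma> (a + s))"
  using assms(2)
proof (induction s arbitrary: a)
  case 0
  have "block_swap a 0 1 = id" by (auto simp: block_swap_def)
  then show ?case by (simp add: psgn_def)
next
  case (Suc s)
  let ?b = "block_swap (Suc a) s 1"
  \<comment> \<open>The shorter interchange brings the entry to position \<open>Suc a\<close>; one
    more transposition takes it to \<open>a\<close>.\<close>
  have eq: "\<sigma> \<circ> block_swap a (Suc s) 1 = \<sigma> \<circ> ?b \<circ> transpose a (Suc a)"
    by (auto simp: block_swap_def transpose_def fun_eq_iff)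
  have "chi (\<sigma> \<circ> ?b \<circ> transpose a (Suc a)) ds =
      - chi (\<sigma> \<circ> ?b) ds * psgn (ds ! \<sigma> (?b a) * ds ! \<sigma> (?b (Suc a)))"
    using chi_transpose_Suc[OF permutes_compose[OF permutes_block_swap[of "Suc a" s 1] assms(1)], of a]
      Suc.prems by simp
  moreover have "?b a = a" "?b (Suc a) = Suc (a + s)" by (auto simp: block_swap_def)
  moreover have "(\<Sum>r=a..<a + Suc s. ds ! \<sigma> r) = ds ! \<sigma> a + (\<Sum>r=Suc a..<Suc (a + s). ds ! \<sigma> r)"
    by (simp add: sum.atLeast_Suc_lessThan del: sum.op_ivl_Suc)
  moreover have "chi (\<sigma> \<circ> ?b) ds =
      chi \<sigma> ds * (-1) ^ s * psgn ((\<Sum>r=Suc a..<Suc (a + s). ds ! \<sigma> r) * ds ! \<sigma> (Suc (a + s)))"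
    using Suc.IH[of "Suc a"] Suc.prems by (simp only: add_Suc add_Suc_right)
  ultimately show ?case
    unfolding eq by (simp only: psgn_add distrib_right distrib_left power_Suc add_Suc_right mult_ac
        mult_minus_left mult_minus_right mult_1_left)
qed

text \<open>The entries of the second block are carried across the first block one after the other,
  each by the one-entry case.\<close>

lemma chi_block_swap:
  assumes "\<sigma> permutes {..<length ds}" "a + s + t \<le> length ds"
  shows "chi (\<sigma> \<circ> block_swap a s t) ds = chi \<sigma> ds * (-1) ^ (s * t) *
    psgn ((\<Sum>r=a..<a + s. ds ! \<sigma> r) * (\<Sum>r=a + s..<a + s + t. ds ! \<sigma> r))"
  using assms(2)
proof (induction t)
  case 0
  have "block_swap a s 0 = id" by (auto simp: block_swap_def)
  then show ?case by (simp add: psgn_def)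
next
  case (Suc t)
  let ?b = "block_swap a s t"
  have eq: "\<sigma> \<circ> block_swap a s (Suc t) = \<sigma> \<circ> ?b \<circ> block_swap (a + t) s 1"
    by (auto simp: block_swap_def fun_eq_iff)
  have "chi (\<sigma> \<circ> ?b \<circ> block_swap (a + t) s 1) ds = chi (\<sigma> \<circ> ?b) ds * (-1) ^ s *
      psgn ((\<Sum>r=a + t..<a + t + s. ds ! \<sigma> (?b r)) * ds ! \<sigma> (?b (a + t + s)))"
    using chi_block_swap_one[OF permutes_compose[OF permutes_block_swap[of a s t] assms(1)], of "a + t" s]
      Suc.prems by simp
  moreover have "?b (a + t + s) = a + s + t" by (auto simp: block_swap_def)
  \<comment> \<open>After \<open>t\<close> entries have passed, the first block occupies the
    positions from \<open>a + t\<close> on, with the same total degree.\<close>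
  moreover have "(\<Sum>r=a + t..<a + t + s. ds ! \<sigma> (?b r)) = (\<Sum>r=a..<a + s. ds ! \<sigma> r)"
    by (rule sum.reindex_bij_witness[where j = "\<lambda>r. r - t" and i = "\<lambda>r. r + t"])
       (auto simp: block_swap_def)
  moreover have "chi (\<sigma> \<circ> ?b) ds = chi \<sigma> ds * (-1) ^ (s * t) *
      psgn ((\<Sum>r=a..<a + s. ds ! \<sigma> r) * (\<Sum>r=a + s..<a + s + t. ds ! \<sigma> r))"
    by (rule Suc.IH) (use Suc.prems in simp)
  moreover have "(\<Sum>r=a + s..<a + s + Suc t. ds ! \<sigma> r) =
      (\<Sum>r=a + s..<a + s + t. ds ! \<sigma> r) + ds ! \<sigma> (a + s + t)"
    by simp
  ultimately show ?case
    unfolding eq by (simp only: psgn_add distrib_left power_add mult_Suc_right mult_ac)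
qed

section \<open>Unshuffles and bijections between them\<close>

lemma unshufflesI:
  assumes "\<sigma> permutes {..<n}"
    and "\<And>a b. a < b \<Longrightarrow> b < j \<Longrightarrow> \<sigma> a < \<sigma> b"
    and "\<And>a b. j \<le> a \<Longrightarrow> a < b \<Longrightarrow> b < n \<Longrightarrow> \<sigma> a < \<sigma> b"
  shows "\<sigma> \<in> unshuffles j n"
  using assms by (auto simp: unshuffles_def strict_mono_on_def)

lemma unshuffles_permutes: "\<sigma> \<in> unshuffles j n \<Longrightarrow> \<sigma> permutes {..<n}"
  by (simp add: unshuffles_def)

lemma unshuffles_less:
  assumes "\<sigma> \<in> unshuffles j n" "a < b" "b < j \<or> j \<le> a \<and> b < n"
  shows "\<sigma> a < \<sigma> b"
  using assms by (auto simp: unshuffles_def strict_mono_on_def)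

lemma finite_unshuffles [simp]: "finite (unshuffles j n)"
  by (rule finite_subset[of _ "{\<sigma>. \<sigma> permutes {..<n}}"]) (auto simp: unshuffles_def finite_permutations)

lemma permutes_mono_id:
  fixes \<sigma> :: "nat \<Rightarrow> nat"
  assumes "\<sigma> permutes {..<n}" "\<And>a b. a < b \<Longrightarrow> b < n \<Longrightarrow> \<sigma> a < \<sigma> b"
  shows "\<sigma> = id"
proof -
  have "map \<sigma> [0..<n] = [0..<n]"
  proof (rule sorted_distinct_set_unique)
    show "sorted (map \<sigma> [0..<n])"
      using assms(2) by (auto simp: sorted_iff_nth_mono_less intro: less_imp_le)
    show "distinct (map \<sigma> [0..<n])"
      using permutes_inj_on[OF assms(1)] by (simp add: distinct_map)
    show "set (map \<sigma> [0..<n]) = set [0..<n]"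
      using permutes_image[OF assms(1)] by (simp add: atLeast0LessThan)
  qed auto
  then have "\<sigma> a = a" if "a < n" for a
    using that by (metis add_0 length_map length_upt minus_nat.diff_0 nth_map nth_upt)
  then show ?thesis
    using permutes_not_in[OF assms(1)] by (metis eq_id_iff lessThan_iff)
qed

text \<open>With one block empty the permutation is increasing throughout. These are the extreme
  terms \<open>s = 0\<close> and \<open>s = n\<close>, from which the differential arises.\<close>

lemma unshuffles_trivial [simp]: "unshuffles 0 n = {id}" "unshuffles n n = {id}"
proof -
  have "\<sigma> = id" if "\<sigma> \<in> unshuffles 0 n" for \<sigma>
    by (rule permutes_mono_id[OF unshuffles_permutes[OF that]]) (rule unshuffles_less[OF that], auto)
  moreover have "\<sigma> = id" if "\<sigma> \<in> unshuffles n n" for \<sigma>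
    by (rule permutes_mono_id[OF unshuffles_permutes[OF that]]) (rule unshuffles_less[OF that], auto)
  moreover have "id \<in> unshuffles 0 n" "id \<in> unshuffles n n"
    by (auto intro!: unshufflesI permutes_id)
  ultimately show "unshuffles 0 n = {id}" "unshuffles n n = {id}" by blast+
qed

text \<open>Interchanging the blocks keeps each of them increasing, and the opposite interchange
  undoes it.\<close>

lemma bij_betw_block_swap_unshuffles:
  assumes "s + t = n"
  shows "bij_betw (\<lambda>\<tau>. \<tau> \<circ> block_swap 0 s t) (unshuffles s n) (unshuffles t n)"
proof (rule bij_betw_byWitness[where f' = "\<lambda>\<tau>. \<tau> \<circ> block_swap 0 t s"])
  have *: "\<tau> \<circ> block_swap 0 s t \<in> unshuffles t n" if "s + t = n" "\<tau> \<in> unshuffles s n" for \<tau> s t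
  proof (rule unshufflesI)
    show "\<tau> \<circ> block_swap 0 s t permutes {..<n}"
      by (intro permutes_compose permutes_block_swap unshuffles_permutes[OF that(2)]) (use that in simp)
  qed (use that in \<open>auto simp: block_swap_def intro!: unshuffles_less[OF that(2)]\<close>)
  show "(\<lambda>\<tau>. \<tau> \<circ> block_swap 0 s t) ` unshuffles s n \<subseteq> unshuffles t n"
    "(\<lambda>\<tau>. \<tau> \<circ> block_swap 0 t s) ` unshuffles t n \<subseteq> unshuffles s n"
    using * assms by (auto simp: add.commute)
qed (simp_all add: comp_assoc)

text \<open>The interchange carries the value \<open>n\<close>, fixed by \<open>\<tau>\<close>, to
  position \<open>s\<close>. Exceeding all other values, it may close the first block without
  breaking the order there; moving it back to the end gives the inverse.\<close>

lemma bij_betw_unshuffles_Suc: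
  assumes "s \<le> n"
  shows "bij_betw (\<lambda>\<tau>. \<tau> \<circ> block_swap s (n - s) 1) (unshuffles s n)
    {\<sigma> \<in> unshuffles (Suc s) (Suc n). \<sigma> s = n}"
proof (rule bij_betw_byWitness[where f' = "\<lambda>\<tau>. \<tau> \<circ> block_swap s 1 (n - s)"])
  show "(\<lambda>\<tau>. \<tau> \<circ> block_swap s (n - s) 1) ` unshuffles s n \<subseteq> {\<sigma> \<in> unshuffles (Suc s) (Suc n). \<sigma> s = n}"
  proof (safe del: disjE intro!: unshufflesI)
    fix \<tau> assume \<tau>: "\<tau> \<in> unshuffles s n"
    have p: "\<tau> permutes {..<n}" by (rule unshuffles_permutes[OF \<tau>])
    have n: "\<tau> n = n" using permutes_not_in[OF p] by simp
    have lt: "\<tau> a < n" if "a < n" for a using permutes_in_image[OF p, of a] that by simp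
    show "\<tau> \<circ> block_swap s (n - s) 1 permutes {..<Suc n}"
      by (intro permutes_compose permutes_block_swap permutes_subset[OF p]) (use assms in auto)
    show "(\<tau> \<circ> block_swap s (n - s) 1) s = n"
      using assms n by (simp add: block_swap_def)
    fix a b :: nat assume "a < b"
    then show "b < Suc s \<Longrightarrow> (\<tau> \<circ> block_swap s (n - s) 1) a < (\<tau> \<circ> block_swap s (n - s) 1) b"
      using assms n lt[of a] \<open>a < b\<close>
      by (cases "b = s") (auto simp: block_swap_def intro!: unshuffles_less[OF \<tau>])
    show "Suc s \<le> a \<Longrightarrow> b < Suc n \<Longrightarrow> (\<tau> \<circ> block_swap s (n - s) 1) a < (\<tau> \<circ> block_swap s (n - s) 1) b"
      using assms \<open>a < b\<close> by (auto simp: block_swap_def intro!: unshuffles_less[OF \<tau>])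
  qed
  show "(\<lambda>\<tau>. \<tau> \<circ> block_swap s 1 (n - s)) ` {\<sigma> \<in> unshuffles (Suc s) (Suc n). \<sigma> s = n} \<subseteq> unshuffles s n"
  proof (rule image_subsetI)
    fix \<sigma> assume "\<sigma> \<in> {\<sigma> \<in> unshuffles (Suc s) (Suc n). \<sigma> s = n}"
    then have \<sigma>: "\<sigma> \<in> unshuffles (Suc s) (Suc n)" and s: "\<sigma> s = n" by auto
    let ?\<tau> = "\<sigma> \<circ> block_swap s 1 (n - s)"
    have p: "?\<tau> permutes {..<Suc n}"
      by (intro permutes_compose permutes_block_swap unshuffles_permutes[OF \<sigma>]) (use assms in simp)
    have n: "?\<tau> n = n"
      using assms s by (simp add: block_swap_def)
    show "?\<tau> \<in> unshuffles s n"
    proof (rule unshufflesI)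
      show "?\<tau> permutes {..<n}"
        by (rule permutes_superset[OF p]) (use n in \<open>auto simp: less_Suc_eq\<close>)
    qed (use assms in \<open>auto simp: block_swap_def intro!: unshuffles_less[OF \<sigma>]\<close>)
  qed
qed (simp_all add: comp_assoc)

text \<open>The largest value \<open>n\<close> can only stand at the end of an increasing block. If
  it does not end the first block, at position \<open>i - 1\<close>, it ends the second one and is
  fixed.\<close>

lemma unshuffles_fixing_last:
  assumes "1 \<le> i" "i \<le> n"
  shows "{\<sigma> \<in> unshuffles i (Suc n). \<sigma> (i - 1) \<noteq> n} = unshuffles i n"
proof (rule set_eqI, rule iffI)
  fix \<sigma> assume "\<sigma> \<in> {\<sigma> \<in> unshuffles i (Suc n). \<sigma> (i - 1) \<noteq> n}"
  then have \<sigma>: "\<sigma> \<in> unshuffles i (Suc n)" and ne: "\<sigma> (i - 1) \<noteq> n" by auto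
  have p: "\<sigma> permutes {..<Suc n}" by (rule unshuffles_permutes[OF \<sigma>])
  have "n \<in> \<sigma> ` {..<Suc n}" by (simp add: permutes_image[OF p])
  then obtain r where r: "r < Suc n" "\<sigma> r = n" by auto
  have le: "\<sigma> a \<le> n" if "a \<le> n" for a
    using permutes_in_image[OF p, of a] that by simp
  have "\<sigma> n = n"
  proof (rule ccontr)
    assume *: "\<sigma> n \<noteq> n"
    then have rn: "r < n" "r \<noteq> i - 1" using r ne by (auto simp: less_Suc_eq)
    then consider "r < i - 1" | "i \<le> r" using assms by linarith
    then show False
    proof cases
      case 1
      then have "\<sigma> r < \<sigma> (i - 1)" using assms by (intro unshuffles_less[OF \<sigma>]) auto
      then show ?thesis using r le[of "i - 1"] assms by linarith
    next
      case 2
      then have "\<sigma> r < \<sigma> n" using rn by (intro unshuffles_less[OF \<sigma>]) auto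
      then show ?thesis using r le[of n] by simp
    qed
  qed
  then have "\<sigma> permutes {..<n}"
    by (intro permutes_superset[OF p]) (auto simp: less_Suc_eq)
  then show "\<sigma> \<in> unshuffles i n"
    by (rule unshufflesI) (auto intro: unshuffles_less[OF \<sigma>])
next
  fix \<sigma> assume \<sigma>: "\<sigma> \<in> unshuffles i n"
  have p: "\<sigma> permutes {..<n}" by (rule unshuffles_permutes[OF \<sigma>])
  have n: "\<sigma> n = n" using permutes_not_in[OF p] by simp
  have lt: "\<sigma> a < n" if "a < n" for a using permutes_in_image[OF p, of a] that by simp
  have "\<sigma> \<in> unshuffles i (Suc n)"
  proof (rule unshufflesI)
    show "\<sigma> permutes {..<Suc n}" by (rule permutes_subset[OF p]) auto
    fix a b :: nat assume "a < b"
    then show "b < i \<Longrightarrow> \<sigma> a < \<sigma> b"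
      by (auto intro: unshuffles_less[OF \<sigma>])
    show "i \<le> a \<Longrightarrow> b < Suc n \<Longrightarrow> \<sigma> a < \<sigma> b"
      using \<open>a < b\<close> n lt[of a] by (cases "b = n") (auto intro: unshuffles_less[OF \<sigma>])
  qed
  moreover have "\<sigma> (i - 1) < n" using lt assms by simp
  ultimately show "\<sigma> \<in> {\<sigma> \<in> unshuffles i (Suc n). \<sigma> (i - 1) \<noteq> n}" by simp
qed


section \<open>Comparison of the two relations\<close>

lemma length_args [simp]: "length (args \<sigma> a b xs) = b - a"
  by (simp add: args_def)

lemma sum_list_args: "sum_list (args \<sigma> a b xs) = (\<Sum>r=a..<b. xs ! \<sigma> r)"
  by (simp add: args_def interv_sum_list_conv_sum_set_nat)

lemma args_id [simp]: "args id 0 (length xs) xs = xs"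
  by (simp add: args_def map_nth)

lemma args_empty [simp]: "args \<sigma> a a xs = []"
  by (simp add: args_def)

text \<open>The shift is split into \<open>+ c - d\<close> to cover both directions over the natural
  numbers; \<open>d \<le> a + c\<close> keeps the subtraction exact.\<close>

lemma args_reindex:
  assumes "\<And>r. a \<le> r \<Longrightarrow> r < b \<Longrightarrow> xs ! \<sigma> r = ys ! \<tau> (r + c - d)" "d \<le> a + c"
  shows "args \<sigma> a b xs = args \<tau> (a + c - d) (b + c - d) ys"
  by (rule nth_equalityI) (use assms in \<open>auto simp: args_def add_ac\<close>)

lemma chi_id [simp]: "chi id ds = 1"
proof -
  have "{(a::nat, b). a < b \<and> b < length ds \<and> id b < id a} = {}" by auto
  then show ?thesis by (simp only: chi_def koszul_sign_def sign_id prod.empty mult_1_left)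
qed

text \<open>Both parametrisations occur: the inner arity is the first index in the module relation
  and the second one in the terms of the weak relation that contain \<open>l\<close>.\<close>

lemma sum_add_eq:
  fixes g :: "nat \<Rightarrow> nat \<Rightarrow> 'a::comm_monoid_add"
  shows "(\<Sum>(i, j) | 1 \<le> i \<and> 1 \<le> j \<and> i + j = n. g i j) = (\<Sum>i=1..<n. g i (n - i))"
    and "(\<Sum>(i, j) | 1 \<le> i \<and> 1 \<le> j \<and> i + j = n. g i j) = (\<Sum>j=1..<n. g (n - j) j)"
  by (rule sum.reindex_bij_witness[where j = fst and i = "\<lambda>i. (i, n - i)"]; auto)
    (rule sum.reindex_bij_witness[where j = snd and i = "\<lambda>j. (n - j, j)"]; auto)

lemma sum_fun_apply: "sum g A x = (\<Sum>a\<in>A. g a x)"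
  by (induction A rule: infinite_finite_induct) auto

text \<open>Here \<open>i = Suc s\<close> and \<open>t = j - 1\<close>. Moving the module element of
  degree \<open>q\<close> into the inner block costs \<open>(-1) ^ t * psgn (d2 * q)\<close>, and
  the last group of factors is \<open>\<alpha>\<close>; the exponent \<open>d2 * q\<close> occurs in
  both and cancels.\<close>

lemma sign_last_block:
  "(-1) ^ t * psgn (d2 * q) * (-1) ^ (Suc s * t) * ((-1) ^ t * psgn ((int (Suc s) + (d1 + q)) * d2))
    = (-1) ^ (Suc s * t) * psgn ((int s + 1 + d1) * d2)"
  unfolding power_minus_one_psgn psgn_add[symmetric] by (rule psgn_cong) auto

text \<open>The module relation of arity \<open>n + 1\<close> with the module element taken out of
  the unshuffles: first the composites of two operators, then the terms with an inner
  \<open>l\<close>. The degree of \<open>v\<close> does not occur, so homogeneity of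
  \<open>v\<close> plays no part in the formula.\<close>

definition reduced_relation ::
    "('k::field \<Rightarrow> 'v::ab_group_add \<Rightarrow> 'v) \<Rightarrow> ('l list \<Rightarrow> 'l) \<Rightarrow> ('l list \<Rightarrow> 'v \<Rightarrow> 'v) \<Rightarrow>
     int list \<Rightarrow> 'l list \<Rightarrow> 'v \<Rightarrow> 'v"
  where "reduced_relation scale l k ds xs v = (let n = length xs in
    (\<Sum>s=0..n. \<Sum>\<sigma>\<in>unshuffles s n. scale (of_int (chi \<sigma> ds * ((-1) ^ (Suc s * (n - s)) *
        psgn ((int s + 1 + sum_list (args \<sigma> 0 s ds)) * sum_list (args \<sigma> s n ds)))))
      (k (args \<sigma> s n xs) (k (args \<sigma> 0 s xs) v)))
    + (\<Sum>i=1..n. \<Sum>\<sigma>\<in>unshuffles i n. scale (of_int (chi \<sigma> ds * (-1) ^ (i * (n + 1 - i))))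
      (k (l (args \<sigma> 0 i xs) # args \<sigma> i n xs) v)))"

section \<open>The module relation without its module element\<close>

context vector_space
begin

text \<open>An unshuffle either ends its first block with the module position \<open>n\<close>, and
  the inner operation acts on the module element, or it fixes \<open>n\<close>. Removing that
  position turns the two kinds, \<open>?A\<close> and \<open>?B\<close>, into the two sums.\<close>

lemma module_relation_eq_reduced_relation:
  assumes n: "length xs = n" "length ds = n"
  shows "(\<Sum>(i, j) | 1 \<le> i \<and> 1 \<le> j \<and> i + j = Suc n + 1. \<Sum>\<sigma>\<in>unshuffles i (Suc n).
      scale (of_int (chi \<sigma> (ds @ [q]) * (-1) ^ (i * (j - 1))))
        (module_term scale l k i j \<sigma> (ds @ [q]) xs v)) = reduced_relation scale l k ds xs v"
proof -
  define T where "T i \<sigma> = scale (of_int (chi \<sigma> (ds @ [q]) * (-1) ^ (i * (Suc n - i))))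
      (module_term scale l k i (Suc n + 1 - i) \<sigma> (ds @ [q]) xs v)" for i \<sigma>
  let ?A = "\<lambda>i. {\<sigma> \<in> unshuffles i (Suc n). \<sigma> (i - 1) = n}"
  let ?B = "\<lambda>i. {\<sigma> \<in> unshuffles i (Suc n). \<sigma> (i - 1) \<noteq> n}"
  have A: "sum (T (Suc s)) (?A (Suc s)) = (\<Sum>\<sigma>\<in>unshuffles s n.
      scale (of_int (chi \<sigma> ds * ((-1) ^ (Suc s * (n - s)) *
        psgn ((int s + 1 + sum_list (args \<sigma> 0 s ds)) * sum_list (args \<sigma> s n ds)))))
      (k (args \<sigma> s n xs) (k (args \<sigma> 0 s xs) v)))" if s: "s \<le> n" for s
  proof -
    have "?A (Suc s) = {\<sigma> \<in> unshuffles (Suc s) (Suc n). \<sigma> s = n}" by simp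
    then have "sum (T (Suc s)) (?A (Suc s)) =
        (\<Sum>\<tau>\<in>unshuffles s n. T (Suc s) (\<tau> \<circ> block_swap s (n - s) 1))"
      using sum.reindex_bij_betw[OF bij_betw_unshuffles_Suc[OF s], of "T (Suc s)"] by simp
    also have "\<dots> = (\<Sum>\<sigma>\<in>unshuffles s n.
      scale (of_int (chi \<sigma> ds * ((-1) ^ (Suc s * (n - s)) *
        psgn ((int s + 1 + sum_list (args \<sigma> 0 s ds)) * sum_list (args \<sigma> s n ds)))))
      (k (args \<sigma> s n xs) (k (args \<sigma> 0 s xs) v)))"
    proof (rule sum.cong[OF refl])
      fix \<tau> assume "\<tau> \<in> unshuffles s n"
      then have p: "\<tau> permutes {..<n}" by (rule unshuffles_permutes)
      have \<tau>n: "\<tau> n = n" using permutes_not_in[OF p] by simp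
      have lt: "\<tau> a < n" if "a < n" for a using permutes_in_image[OF p, of a] that by simp
      define \<sigma> where "\<sigma> = \<tau> \<circ> block_swap s (n - s) 1"
      have \<sigma>: "\<sigma> r = \<tau> r" if "r < s" for r
        using that by (simp add: \<sigma>_def block_swap_def)
      have \<sigma>s: "\<sigma> s = n" using s \<tau>n by (simp add: \<sigma>_def block_swap_def)
      have \<sigma>': "\<sigma> r = \<tau> (r - 1)" if "Suc s \<le> r" "r < Suc n" for r
        using that s by (auto simp: \<sigma>_def block_swap_def)
      \<comment> \<open>Position \<open>s\<close> of \<open>\<sigma>\<close> holds the module
        element, so the second block of \<open>\<tau>\<close> appears one place further
        right.\<close>
      have 1: "args \<sigma> (Suc s) (Suc n) xs = args \<tau> s n xs"
        using args_reindex[of "Suc s" "Suc n" xs \<sigma> xs \<tau> 0 1] \<sigma>' by simp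
      have 2: "args \<sigma> 0 s xs = args \<tau> 0 s xs"
        using args_reindex[of 0 s xs \<sigma> xs \<tau> 0 0] \<sigma> by simp
      have 3: "args \<sigma> (Suc s) (Suc n) (ds @ [q]) = args \<tau> s n ds"
        using args_reindex[of "Suc s" "Suc n" "ds @ [q]" \<sigma> ds \<tau> 0 1] \<sigma>' lt n
        by (auto simp: nth_append)
      have 4: "args \<sigma> 0 s (ds @ [q]) = args \<tau> 0 s ds"
        using args_reindex[of 0 s "ds @ [q]" \<sigma> ds \<tau> 0 0] \<sigma> lt s n by (auto simp: nth_append)
      have 5: "sum_list (args \<sigma> 0 (Suc s) (ds @ [q])) = sum_list (args \<tau> 0 s ds) + q"
      proof -
        have "args \<sigma> 0 (Suc s) (ds @ [q]) = args \<sigma> 0 s (ds @ [q]) @ [q]"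
          using \<sigma>s n by (simp add: args_def nth_append)
        then show ?thesis unfolding 4 by simp
      qed
      \<comment> \<open>Bringing the module element from the end to position \<open>s\<close>
        interchanges it with the \<open>n - s\<close> entries of the second block.\<close>
      have "chi \<sigma> (ds @ [q]) = chi \<tau> (ds @ [q]) * (-1) ^ (n - s) *
          psgn ((\<Sum>r=s..<n. (ds @ [q]) ! \<tau> r) * (ds @ [q]) ! \<tau> n)"
        unfolding \<sigma>_def
        using chi_block_swap[of \<tau> "ds @ [q]" s "n - s" 1] permutes_subset[OF p, of "{..<Suc n}"] s n
        by (simp add: lessThan_Suc subset_insertI)
      also have "chi \<tau> (ds @ [q]) = chi \<tau> ds"
        using chi_append[of \<tau> ds q] p n by simp
      also have "(\<Sum>r=s..<n. (ds @ [q]) ! \<tau> r) = sum_list (args \<tau> s n ds)"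
        unfolding sum_list_args by (rule sum.cong) (use lt n in \<open>auto simp: nth_append\<close>)
      also have "(ds @ [q]) ! \<tau> n = q" using \<tau>n n by (simp add: nth_append)
      finally have c: "chi \<sigma> (ds @ [q]) =
          chi \<tau> ds * (-1) ^ (n - s) * psgn (sum_list (args \<tau> s n ds) * q)" .
      have sg: "chi \<sigma> (ds @ [q]) * (-1) ^ (Suc s * (n - s)) * ((-1) ^ (n - s) *
          psgn ((int (Suc s) + (sum_list (args \<tau> 0 s ds) + q)) * sum_list (args \<tau> s n ds))) =
        chi \<tau> ds * ((-1) ^ (Suc s * (n - s)) *
          psgn ((int s + 1 + sum_list (args \<tau> 0 s ds)) * sum_list (args \<tau> s n ds)))"
        unfolding c
        using sign_last_block[of "n - s" "sum_list (args \<tau> s n ds)" q s "sum_list (args \<tau> 0 s ds)"]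
        by (simp only: mult.assoc)
      have "module_term scale l k (Suc s) (Suc n + 1 - Suc s) \<sigma> (ds @ [q]) xs v =
          scale (of_int ((-1) ^ (n - s) * psgn ((int (Suc s) + (sum_list (args \<tau> 0 s ds) + q)) *
            sum_list (args \<tau> s n ds)))) (k (args \<tau> s n xs) (k (args \<tau> 0 s xs) v))"
        using s \<sigma>s by (simp only: module_term_def Let_def 1 2 3 5) (simp add: 1 2 3 5 Suc_diff_le)
      then have "T (Suc s) \<sigma> = scale (of_int (chi \<sigma> (ds @ [q]) * (-1) ^ (Suc s * (n - s)) *
          ((-1) ^ (n - s) * psgn ((int (Suc s) + (sum_list (args \<tau> 0 s ds) + q)) *
            sum_list (args \<tau> s n ds))))) (k (args \<tau> s n xs) (k (args \<tau> 0 s xs) v))"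
        unfolding T_def by (simp only: scale_scale of_int_mult diff_Suc_Suc)
      then show "T (Suc s) (\<tau> \<circ> block_swap s (n - s) 1) =
        scale (of_int (chi \<tau> ds * ((-1) ^ (Suc s * (n - s)) *
          psgn ((int s + 1 + sum_list (args \<tau> 0 s ds)) * sum_list (args \<tau> s n ds)))))
        (k (args \<tau> s n xs) (k (args \<tau> 0 s xs) v))"
        unfolding sg \<sigma>_def[symmetric] .
    qed
    finally show ?thesis .
  qed
  have B: "sum (T i) (?B i) = (\<Sum>\<sigma>\<in>unshuffles i n. scale (of_int (chi \<sigma> ds * (-1) ^ (i * (n + 1 - i))))
      (k (l (args \<sigma> 0 i xs) # args \<sigma> i n xs) v))" if i: "1 \<le> i" "i \<le> n" for i
    unfolding unshuffles_fixing_last[OF i]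
  proof (rule sum.cong[OF refl])
    fix \<sigma> assume "\<sigma> \<in> unshuffles i n"
    then have p: "\<sigma> permutes {..<n}" by (rule unshuffles_permutes)
    have "\<sigma> (i - 1) < n" using permutes_in_image[OF p, of "i - 1"] i by simp
    then have "module_term scale l k i (Suc n + 1 - i) \<sigma> (ds @ [q]) xs v =
        k (l (args \<sigma> 0 i xs) # args \<sigma> i n xs) v"
      using i by (simp add: module_term_def)
    then show "T i \<sigma> = scale (of_int (chi \<sigma> ds * (-1) ^ (i * (n + 1 - i))))
        (k (l (args \<sigma> 0 i xs) # args \<sigma> i n xs) v)"
      using chi_append[of \<sigma> ds q] p n by (simp add: T_def)
  qed
  have "(\<Sum>(i, j) | 1 \<le> i \<and> 1 \<le> j \<and> i + j = Suc n + 1. \<Sum>\<sigma>\<in>unshuffles i (Suc n).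
      scale (of_int (chi \<sigma> (ds @ [q]) * (-1) ^ (i * (j - 1))))
        (module_term scale l k i j \<sigma> (ds @ [q]) xs v)) =
      (\<Sum>i=1..<Suc n + 1. sum (T i) (unshuffles i (Suc n)))"
    unfolding sum_add_eq(1) T_def by (rule sum.cong) (auto simp: Suc_diff_le)
  also have "\<dots> = (\<Sum>i=1..<Suc n + 1. sum (T i) (?A i) + sum (T i) (?B i))"
  proof (rule sum.cong[OF refl])
    fix i
    show "sum (T i) (unshuffles i (Suc n)) = sum (T i) (?A i) + sum (T i) (?B i)"
      by (subst sum.union_disjoint[symmetric]) (auto intro!: arg_cong2[where f = sum])
  qed
  also have "\<dots> = (\<Sum>i=1..<Suc n + 1. sum (T i) (?A i)) + (\<Sum>i=1..<Suc n + 1. sum (T i) (?B i))"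
    by (rule sum.distrib)
  also have "(\<Sum>i=1..<Suc n + 1. sum (T i) (?A i)) = (\<Sum>s=0..n. sum (T (Suc s)) (?A (Suc s)))"
    by (rule sum.reindex_bij_witness[where i = Suc and j = "\<lambda>i. i - 1"]) auto
  \<comment> \<open>For \<open>i = Suc n\<close> the only unshuffle is the identity, which puts the
    module element into the inner operation; hence \<open>?B i\<close> is empty.\<close>
  also have "(\<Sum>i=1..<Suc n + 1. sum (T i) (?B i)) = (\<Sum>i=1..n. sum (T i) (?B i))"
  proof (rule sum.mono_neutral_right)
    show "\<forall>i\<in>{1..<Suc n + 1} - {1..n}. sum (T i) (?B i) = 0"
    proof
      fix i assume "i \<in> {1..<Suc n + 1} - {1..n}"
      then have "i = Suc n" by auto
      then have "?B i = {}" by auto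
      then show "sum (T i) (?B i) = 0" by (simp only: sum.empty)
    qed
  qed auto
  finally show ?thesis
    using A B n by (simp add: reduced_relation_def)
qed

end

text \<open>
  The signs with which \<open>k(\<xi>\<^sub>1, \<dots>, \<xi>\<^sub>s, -)\<close> and \<open>k(\<xi>\<^bsub>s+1\<^esub>, \<dots>, \<xi>\<^sub>n, -)\<close>, where \<open>n = s + t\<close>, are composed
  in \<open>[f\<^sub>s, f\<^sub>t]\<close>, in either order, agree with those of the module relation up to \<open>(-1)\<^bsup>n+1\<^esup>\<close>; here
  \<open>a\<close> and \<open>b\<close> are the total degrees of the two groups.
\<close>

lemma sign_bracket_right:
  assumes "1 \<le> s" "1 \<le> t"
  shows "- ((-1) ^ (s - 1) * psgn ((int t - 1) * a) * psgn ((a + int s - 1) * (b + int t - 1)) *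
      (-1) ^ (t - 1) * (-1) ^ (s - 1)) =
    (-1) ^ (s + t + 1) * ((-1) ^ (Suc s * t) * psgn ((int s + 1 + a) * b))"
proof -
  \<comment> \<open>Successors remove the truncated differences \<open>s - 1\<close> and
    \<open>t - 1\<close>, leaving a comparison of parities.\<close>
  obtain s' t' where "s = Suc s'" "t = Suc t'" using assms by (metis Suc_le_D One_nat_def)
  moreover have "- psgn x = psgn (1 + x)" for x by (simp add: psgn_def)
  ultimately show ?thesis
    unfolding power_minus_one_psgn psgn_add[symmetric] by (auto intro!: psgn_cong)
qed

lemma sign_bracket_left:
  assumes "1 \<le> s" "1 \<le> t"
  shows "(-1) ^ (s - 1) * psgn ((int t - 1) * a) * (-1) ^ (s - 1) * (-1) ^ (t - 1) =
    (-1) ^ (s + t + 1) * ((-1) ^ (s * t) * psgn (a * b) *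
      ((-1) ^ (Suc t * s) * psgn ((int t + 1 + b) * a)))"
proof -
  obtain s' t' where "s = Suc s'" "t = Suc t'" using assms by (metis Suc_le_D One_nat_def)
  then show ?thesis
    unfolding power_minus_one_psgn psgn_add[symmetric] by (auto intro!: psgn_cong)
qed

text \<open>On the left stands the sign of the weak relation at \<open>j = n + 1 - i\<close> times
  that of \<open>f\<close> on \<open>n + 1 - i\<close> arguments, on the right the sign of the
  reduced relation times the common factor.\<close>

lemma sign_action:
  assumes "1 \<le> i" "i \<le> n"
  shows "(-1) ^ (i * (n - i) + 1) * (-1) ^ (n - i) = (-1) ^ (n + 1) * ((-1) ^ (i * (n + 1 - i)) :: int)"
proof -
  obtain i' where "i = Suc i'" using assms by (metis Suc_le_D One_nat_def)
  moreover obtain j where "n = i + j" using assms le_Suc_ex by blast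
  ultimately show ?thesis
    unfolding power_minus_one_psgn psgn_add[symmetric] by (auto intro!: psgn_cong)
qed

section \<open>The weak relation evaluated at a module element\<close>

context vector_space
begin

text \<open>The differential yields the composites with \<open>s = 0\<close> and
  \<open>s = n\<close>, the brackets those with \<open>0 < s < n\<close>, and the terms with
  \<open>l\<close> correspond one to one. Linearity of \<open>k\<close> lets the sign in
  \<open>f\<close> pass through an outer operator.\<close>

lemma weak_relation_eq_reduced_relation:
  assumes xs: "xs \<noteq> []" "length xs = n" "length ds = n"
    and f: "\<And>ys. ys \<noteq> [] \<Longrightarrow> f ys = (\<lambda>v. scale (of_int ((-1) ^ (length ys - 1))) (k ys v))"
    and lin: "\<And>ys. length ys \<le> n \<Longrightarrow> Vector_Spaces.linear scale scale (k ys)"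
  shows "(End_diff scale (k []) (sum_list ds + int n - 1) (f xs)
      + (\<Sum>(j, i) | 1 \<le> j \<and> 1 \<le> i \<and> j + i = n + 1. \<Sum>\<sigma>\<in>unshuffles i n.
          End_scale scale (of_int (chi \<sigma> ds * (-1) ^ (i * (j - 1) + 1)))
            (f (l (args \<sigma> 0 i xs) # args \<sigma> i n xs)))
      + (\<Sum>(s, t) | 1 \<le> s \<and> 1 \<le> t \<and> s + t = n. \<Sum>\<tau>\<in>{\<tau> \<in> unshuffles s n. \<tau> 0 < \<tau> s}.
          End_scale scale (of_int (chi \<tau> ds * (-1) ^ (s - 1) *
              psgn ((int t - 1) * sum_list (args \<tau> 0 s ds))))
            (End_bracket scale (sum_list (args \<tau> 0 s ds) + int s - 1) (sum_list (args \<tau> s n ds) + int t - 1)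
              (f (args \<tau> 0 s xs)) (f (args \<tau> s n xs))))) v =
    scale (of_int ((-1) ^ (n + 1))) (reduced_relation scale l k ds xs v)"
proof -
  let ?e = "of_int ((-1) ^ (n + 1))"
  have n1: "1 \<le> n" using xs by (cases xs) auto
  have k_scale: "k ys (scale c u) = scale c (k ys u)" if "length ys \<le> n" for ys c u
    using lin[OF that] by (simp add: Vector_Spaces.linear_iff)
  define X where "X s \<sigma> = scale (of_int (chi \<sigma> ds * ((-1) ^ (Suc s * (n - s)) *
        psgn ((int s + 1 + sum_list (args \<sigma> 0 s ds)) * sum_list (args \<sigma> s n ds)))))
      (k (args \<sigma> s n xs) (k (args \<sigma> 0 s xs) v))" for s \<sigma>
  \<comment> \<open>\<open>X 0 id\<close> applies \<open>k []\<close> first and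
    \<open>X n id\<close> applies it last: the two halves of the differential on
    endomorphisms.\<close>
  have d: "End_diff scale (k []) (sum_list ds + int n - 1) (f xs) v = scale ?e (X 0 id) + scale ?e (X n id)"
  proof -
    have 1: "(-1) ^ (n + 1) * ((-1) ^ n * psgn (sum_list ds)) = - (psgn (sum_list ds + int n - 1) * (-1) ^ (n - 1))"
    proof -
      have m: "- psgn x = psgn (1 + x)" for x by (simp add: psgn_def)
      obtain n' where "n = Suc n'" using n1 by (metis Suc_le_D One_nat_def)
      then show ?thesis
        unfolding power_minus_one_psgn psgn_add[symmetric] m by (auto intro!: psgn_cong)
    qed
    have 2: "(-1) ^ (n + 1) = ((-1) ^ (n - 1) :: int)" using n1 by (cases n) auto
    have "scale ?e (X 0 id) = - scale (of_int (psgn (sum_list ds + int n - 1) * (-1) ^ (n - 1))) (k xs (k [] v))"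
      unfolding X_def scale_scale of_int_mult[symmetric] scale_minus_left[symmetric] of_int_minus[symmetric] 1[symmetric]
      using xs args_id[of xs] args_id[of ds] by simp
    moreover have "scale ?e (X n id) = scale (of_int ((-1) ^ (n - 1))) (k [] (k xs v))"
      unfolding X_def scale_scale of_int_mult[symmetric] 2
      using xs args_id[of xs] args_id[of ds] by (simp add: psgn_def)
    ultimately show ?thesis
      unfolding End_diff_def f[OF xs(1)] using xs
      by (simp add: End_scale_def k_scale del: of_int_power of_int_mult) (simp add: mult.commute)
  qed
  have a: "(\<Sum>(j, i) | 1 \<le> j \<and> 1 \<le> i \<and> j + i = n + 1. \<Sum>\<sigma>\<in>unshuffles i n.
          End_scale scale (of_int (chi \<sigma> ds * (-1) ^ (i * (j - 1) + 1)))
            (f (l (args \<sigma> 0 i xs) # args \<sigma> i n xs))) v =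
      scale ?e (\<Sum>i=1..n. \<Sum>\<sigma>\<in>unshuffles i n. scale (of_int (chi \<sigma> ds * (-1) ^ (i * (n + 1 - i))))
        (k (l (args \<sigma> 0 i xs) # args \<sigma> i n xs) v))"
    unfolding sum_add_eq(2) sum_fun_apply scale_sum_right
  proof (intro sum.cong refl)
    fix i \<sigma> assume "i \<in> {1..n}"
    then have i: "1 \<le> i" "i \<le> n" by auto
    have "chi \<sigma> ds * (-1) ^ (i * (n - i) + 1) * (-1) ^ (n - i) =
        (-1) ^ (n + 1) * (chi \<sigma> ds * (-1) ^ (i * (n + 1 - i)))"
      using sign_action[OF i] by (simp only: mult.assoc mult.left_commute)
    moreover have "n + 1 - i - 1 = n - i" "length (l (args \<sigma> 0 i xs) # args \<sigma> i n xs) - 1 = n - i"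
      by simp_all
    ultimately show "End_scale scale (of_int (chi \<sigma> ds * (-1) ^ (i * (n + 1 - i - 1) + 1)))
            (f (l (args \<sigma> 0 i xs) # args \<sigma> i n xs)) v =
      scale ?e (scale (of_int (chi \<sigma> ds * (-1) ^ (i * (n + 1 - i))))
        (k (l (args \<sigma> 0 i xs) # args \<sigma> i n xs) v))"
      by (simp only: f[OF list.distinct(2)] End_scale_def scale_scale of_int_mult[symmetric])
  qed auto
  let ?P = "\<lambda>s. {\<tau> \<in> unshuffles s n. \<tau> 0 < \<tau> s}"
  let ?N = "\<lambda>s. {\<tau> \<in> unshuffles s n. \<not> \<tau> 0 < \<tau> s}"
  have b: "(\<Sum>(s, t) | 1 \<le> s \<and> 1 \<le> t \<and> s + t = n. \<Sum>\<tau>\<in>?P s.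
          End_scale scale (of_int (chi \<tau> ds * (-1) ^ (s - 1) *
              psgn ((int t - 1) * sum_list (args \<tau> 0 s ds))))
            (End_bracket scale (sum_list (args \<tau> 0 s ds) + int s - 1) (sum_list (args \<tau> s n ds) + int t - 1)
              (f (args \<tau> 0 s xs)) (f (args \<tau> s n xs)))) v =
      (\<Sum>s=1..<n. \<Sum>\<tau>\<in>?P s. scale ?e (X s \<tau>) + scale ?e (X (n - s) (\<tau> \<circ> block_swap 0 s (n - s))))"
    unfolding sum_add_eq(1) sum_fun_apply
  proof (intro sum.cong refl)
    fix s \<tau> assume "s \<in> {1..<n}" and "\<tau> \<in> ?P s"
    then have s: "1 \<le> s" "1 \<le> n - s" "s + (n - s) = n" and p: "\<tau> permutes {..<n}"
      by (auto intro: unshuffles_permutes)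
    let ?D1 = "sum_list (args \<tau> 0 s ds)" and ?D2 = "sum_list (args \<tau> s n ds)"
    let ?k1 = "k (args \<tau> 0 s xs)" and ?k2 = "k (args \<tau> s n xs)"
    \<comment> \<open>The partner of \<open>\<tau>\<close>, with the blocks interchanged. The
      summand of \<open>\<tau>\<close> applies \<open>?k1\<close> first, that of
      \<open>\<tau>'\<close> applies \<open>?k2\<close> first; together they form the
      commutator.\<close>
    define \<tau>' where "\<tau>' = \<tau> \<circ> block_swap 0 s (n - s)"
    have r1: "args \<tau>' 0 (n - s) ys = args \<tau> s n ys" for ys :: "'z list"
      using args_reindex[of 0 "n - s" ys \<tau>' ys \<tau> s 0] s by (simp add: \<tau>'_def block_swap_def)
    have r2: "args \<tau>' (n - s) n ys = args \<tau> 0 s ys" for ys :: "'z list"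
      using args_reindex[of "n - s" n ys \<tau>' ys \<tau> 0 "n - s"] s by (simp add: \<tau>'_def block_swap_def)
    have c: "chi \<tau>' ds = chi \<tau> ds * ((-1) ^ (s * (n - s)) * psgn (?D1 * ?D2))"
      using chi_block_swap[of \<tau> ds 0 s "n - s"] p s xs by (simp add: \<tau>'_def sum_list_args)
    have X1: "scale ?e (X s \<tau>) = - scale (of_int (chi \<tau> ds * ((-1) ^ (s - 1) * psgn ((int (n - s) - 1) * ?D1) *
        psgn ((?D1 + int s - 1) * (?D2 + int (n - s) - 1)) * (-1) ^ (n - s - 1) * (-1) ^ (s - 1)))) (?k2 (?k1 v))"
    proof -
      have "(-1) ^ (n + 1) * (chi \<tau> ds * ((-1) ^ (Suc s * (n - s)) * psgn ((int s + 1 + ?D1) * ?D2))) =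
        - (chi \<tau> ds * ((-1) ^ (s - 1) * psgn ((int (n - s) - 1) * ?D1) *
        psgn ((?D1 + int s - 1) * (?D2 + int (n - s) - 1)) * (-1) ^ (n - s - 1) * (-1) ^ (s - 1)))"
        using arg_cong[OF sign_bracket_right[OF s(1,2), of ?D1 ?D2], of "\<lambda>x. chi \<tau> ds * x"] s(3)
        by (simp only: mult.left_commute mult_minus_right)
      then show ?thesis
        unfolding X_def scale_scale of_int_mult[symmetric] by (simp only: of_int_minus scale_minus_left)
    qed
    have X2: "scale ?e (X (n - s) \<tau>') = scale (of_int (chi \<tau> ds * ((-1) ^ (s - 1) * psgn ((int (n - s) - 1) * ?D1) *
        (-1) ^ (s - 1) * (-1) ^ (n - s - 1)))) (?k1 (?k2 v))"
    proof -
      have "(-1) ^ (n + 1) * (chi \<tau>' ds * ((-1) ^ (Suc (n - s) * (n - (n - s))) *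
          psgn ((int (n - s) + 1 + ?D2) * ?D1))) =
        chi \<tau> ds * ((-1) ^ (s - 1) * psgn ((int (n - s) - 1) * ?D1) * (-1) ^ (s - 1) * (-1) ^ (n - s - 1))"
        unfolding c
        using arg_cong[OF sign_bracket_left[OF s(1,2), of ?D1 ?D2], of "\<lambda>x. chi \<tau> ds * x"] s
        by (simp only: diff_diff_cancel less_imp_le mult.left_commute mult.assoc)
      then show ?thesis
        unfolding X_def scale_scale of_int_mult[symmetric] r1 r2 by simp
    qed
    have f1: "f (args \<tau> 0 s xs) = (\<lambda>v. scale (of_int ((-1) ^ (s - 1))) (?k1 v))"
      using f[of "args \<tau> 0 s xs"] s by (simp add: args_def)
    have f2: "f (args \<tau> s n xs) = (\<lambda>v. scale (of_int ((-1) ^ (n - s - 1))) (?k2 v))"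
      using f[of "args \<tau> s n xs"] s by (simp add: args_def)
    have l: "length (args \<tau> 0 s xs) \<le> n" "length (args \<tau> s n xs) \<le> n" using s by auto
    show "End_scale scale (of_int (chi \<tau> ds * (-1) ^ (s - 1) * psgn ((int (n - s) - 1) * ?D1)))
            (End_bracket scale (?D1 + int s - 1) (?D2 + int (n - s) - 1)
              (f (args \<tau> 0 s xs)) (f (args \<tau> s n xs))) v =
      scale ?e (X s \<tau>) + scale ?e (X (n - s) (\<tau> \<circ> block_swap 0 s (n - s)))"
      unfolding \<tau>'_def[symmetric] X1 X2 End_bracket_def End_scale_def f1 f2
      by (simp only: minus_apply comp_apply k_scale[OF l(1)] k_scale[OF l(2)] scale_right_diff_distrib
          scale_scale of_int_mult[symmetric] mult.assoc) simp
  qed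
  \<comment> \<open>Every unshuffle violating \<open>\<tau> 0 < \<tau> s\<close> is the partner of
    one that satisfies the condition, so the sum over \<open>0 < s < n\<close> runs over
    pairs.\<close>
  have m: "(\<Sum>s=0..n. sum (X s) (unshuffles s n)) = X 0 id + X n id +
      (\<Sum>s=1..<n. \<Sum>\<tau>\<in>?P s. X s \<tau> + X (n - s) (\<tau> \<circ> block_swap 0 s (n - s)))"
  proof -
    have N: "sum (X (n - s)) (?N (n - s)) = (\<Sum>\<tau>\<in>?P s. X (n - s) (\<tau> \<circ> block_swap 0 s (n - s)))"
      if s: "s \<in> {1..<n}" for s
    proof -
      have bij: "bij_betw (\<lambda>\<tau>. \<tau> \<circ> block_swap 0 s (n - s)) (unshuffles s n) (unshuffles (n - s) n)"
        by (rule bij_betw_block_swap_unshuffles) (use s in auto)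
      \<comment> \<open>The first entries of the two blocks trade places, and they are distinct by
        injectivity.\<close>
      have iff: "\<not> (\<tau> \<circ> block_swap 0 s (n - s)) 0 < (\<tau> \<circ> block_swap 0 s (n - s)) (n - s) \<longleftrightarrow> \<tau> 0 < \<tau> s"
        if "\<tau> \<in> unshuffles s n" for \<tau>
        using inj_eq[OF permutes_inj[OF unshuffles_permutes[OF that]], of 0 s] s
        by (auto simp: block_swap_def)
      have "bij_betw (\<lambda>\<tau>. \<tau> \<circ> block_swap 0 s (n - s)) (?P s) (?N (n - s))"
        using bij by (rule bij_betw_Collect) (use iff in blast)
      from sum.reindex_bij_betw[OF this, of "X (n - s)"] show ?thesis by simp
    qed
    have "{0..n} = insert 0 (insert n {1..<n})" using n1 by auto
    then have "(\<Sum>s=0..n. sum (X s) (unshuffles s n)) = X 0 id + X n id +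
        (\<Sum>s=1..<n. sum (X s) (unshuffles s n))"
      using n1 by (simp add: add.assoc)
    also have "(\<Sum>s=1..<n. sum (X s) (unshuffles s n)) = (\<Sum>s=1..<n. sum (X s) (?P s) + sum (X s) (?N s))"
    proof (rule sum.cong[OF refl])
      fix s
      show "sum (X s) (unshuffles s n) = sum (X s) (?P s) + sum (X s) (?N s)"
        by (subst sum.union_disjoint[symmetric]) (auto intro!: arg_cong2[where f = sum])
    qed
    also have "\<dots> = (\<Sum>s=1..<n. sum (X s) (?P s)) + (\<Sum>s=1..<n. sum (X s) (?N s))"
      by (rule sum.distrib)
    also have "(\<Sum>s=1..<n. sum (X s) (?N s)) = (\<Sum>s=1..<n. sum (X (n - s)) (?N (n - s)))"
      by (rule sum.reindex_bij_witness[where i = "\<lambda>s. n - s" and j = "\<lambda>s. n - s"]) auto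
    also have "\<dots> = (\<Sum>s=1..<n. \<Sum>\<tau>\<in>?P s. X (n - s) (\<tau> \<circ> block_swap 0 s (n - s)))"
      by (rule sum.cong[OF refl N])
    finally show ?thesis by (simp only: sum.distrib)
  qed
  show ?thesis
    unfolding plus_fun_apply d a b reduced_relation_def xs(2) Let_def scale_right_distrib
    unfolding X_def[symmetric] m scale_right_distrib scale_sum_right
    by (simp only: ac_simps)
qed

end


section \<open>The correspondence\<close>

text \<open>The arity shift between \<open>f\<close> and \<open>k\<close>. Subtraction is truncated,
  so for \<open>m = 0\<close> the equivalence would fail at \<open>n = 0\<close>.\<close>

lemma enat_le_minus_one_iff: "1 \<le> m \<Longrightarrow> enat n \<le> m - 1 \<longleftrightarrow> enat (Suc n) \<le> m"
  by (cases m) (auto simp: one_enat_def)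

lemma permute_list_eq_Nil_iff: "permute_list \<sigma> xs = [] \<longleftrightarrow> xs = []"
  by (metis length_0_conv length_permute_list)

text \<open>The sign is its own inverse, so the same formula leads from \<open>k\<close> to
  \<open>f\<close> and back.\<close>

lemma of_int_sign_cancel: "of_int ((-1) ^ n) * of_int ((-1) ^ n) = (1 :: 'k::ring_1)"
  by (simp add: minus_one_power_iff)

text \<open>All summands are multiples of structure maps or of composites of two. Linearity allows
  the relation to be tested on homogeneous module elements.\<close>

lemma reduced_relation_linear:
  fixes scale :: "'k::field \<Rightarrow> 'v::ab_group_add \<Rightarrow> 'v"
  assumes "vector_space scale"
    and lin: "\<And>ys. length ys \<le> length xs \<Longrightarrow> Vector_Spaces.linear scale scale (k ys)"
  shows "Vector_Spaces.linear scale scale (reduced_relation scale l k ds xs)"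
proof -
  interpret vector_space scale by fact
  interpret vector_space_pair scale scale ..
  have "Vector_Spaces.linear scale scale (\<lambda>v. k ys (k zs v))"
    if "length ys \<le> length xs" "length zs \<le> length xs" for ys zs
    using Vector_Spaces.linear_compose[OF lin[OF that(2)] lin[OF that(1)]] by (simp add: comp_def)
  then show ?thesis
    unfolding reduced_relation_def Let_def
    by (intro linear_compose_add linear_compose_sum ballI linear_compose_scale_right lin) auto
qed

text \<open>Homogeneous elements span. This bridges the module relation, stated for homogeneous
  \<open>v\<close>, and the weak relation, an equality of operators.\<close>

lemma (in graded_vector_space) linear_eq_0_if_homogeneous:
  assumes "Vector_Spaces.linear scale s \<phi>" "\<And>q v. v \<in> G q \<Longrightarrow> \<phi> v = 0"
  shows "\<phi> v = 0"
proof -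
  interpret Vector_Spaces.linear scale s \<phi> by fact
  show ?thesis by (rule eq_0_on_span[where b = "\<Union>p. G p"]) (use assms(2) span_G in auto)
qed

section \<open>Passage from modules to weak maps and back\<close>

context
  fixes scaleL :: "'k::field_char_0 \<Rightarrow> 'l::ab_group_add \<Rightarrow> 'l" and GL :: "int \<Rightarrow> 'l set"
    and scaleM :: "'k \<Rightarrow> 'v::ab_group_add \<Rightarrow> 'v" and GM :: "int \<Rightarrow> 'v set"
    and m :: enat and l :: "'l list \<Rightarrow> 'l" and k1 :: "'v \<Rightarrow> 'v"
  assumes m: "1 \<le> m"
    and Lm: "Lm_algebra scaleL GL m l"
    and dg: "dg_vector_space scaleM GM k1"
begin

interpretation L: Lm_algebra scaleL GL m l by (rule Lm)
interpretation M: dg_vector_space scaleM GM k1 by (rule dg)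
interpretation MM: vector_space_pair scaleM scaleM ..
interpretation E: vector_space "End_scale scaleM" by (rule End_vector_space) (rule M.vector_space_axioms)

text \<open>The degree axiom puts \<open>f xs\<close> into the endomorphisms only for homogeneous
  arguments; multilinearity extends this to all arguments, since homogeneous elements span
  \<open>L\<close>.\<close>

lemma weak_Lm_map_linear:
  assumes "weak_Lm_map_to_End scaleL GL m l scaleM GM k1 f"
    and n: "1 \<le> length xs" "enat (length xs) \<le> m - 1"
  shows "Vector_Spaces.linear scaleM scaleM (f xs)"
proof -
  interpret F: weak_Lm_map scaleL GL m l "End_scale scaleM" "End_grading scaleM GM"
    "End_diff scaleM k1" "End_bracket scaleM" f by fact
  \<comment> \<open>Induction on the number \<open>j\<close> of leading entries that may be
    inhomogeneous.\<close>
  have "Vector_Spaces.linear scaleM scaleM (f ys)"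
    if "j \<le> length xs" "length ys = length xs" "\<forall>r. j \<le> r \<and> r < length xs \<longrightarrow> (\<exists>p. ys ! r \<in> GL p)" for j ys
    using that
  proof (induction j arbitrary: ys)
    case 0
    then have "\<forall>r. \<exists>p. r < length xs \<longrightarrow> ys ! r \<in> GL p" by auto
    then obtain d where d: "\<And>r. r < length xs \<Longrightarrow> ys ! r \<in> GL (d r)" by metis
    then have "homogeneous GL (map d [0..<length xs]) ys"
      using 0 by (simp add: homogeneous_def list_all2_conv_all_nth)
    then show ?case
      using F.f_degree[of ys] 0 n unfolding End_grading_def by auto
  next
    case (Suc j)
    have ml: "Vector_Spaces.linear scaleL (End_scale scaleM) (\<lambda>x. f (ys[j := x]))"
      using F.f_multilinear[OF n] Suc.prems by (simp add: multilinear_def)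
    interpret h: Vector_Spaces.linear scaleL "End_scale scaleM" "\<lambda>x. f (ys[j := x])" by (rule ml)
    \<comment> \<open>The entry at position \<open>j\<close> is built up from homogeneous ones, for
      which the induction hypothesis applies.\<close>
    have "Vector_Spaces.linear scaleM scaleM (f (ys[j := x]))" if "x \<in> L.span (\<Union>p. GL p)" for x
      using that
    proof (induction rule: L.span_induct_alt)
      case base
      then show ?case using h.zero by (simp add: zero_fun_def MM.linear_zero)
    next
      case (step c x y)
      have "Vector_Spaces.linear scaleM scaleM (f (ys[j := x]))"
        using step(1) Suc.prems by (intro Suc.IH) (auto simp: nth_list_update)
      then show ?case
        unfolding h.add h.scale End_scale_def plus_fun_def
        by (intro MM.linear_compose_add MM.linear_compose_scale_right step)
    qed
    from this[of "ys ! j"] show ?case by (simp add: L.span_G)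
  qed
  note * = this
  show ?thesis by (rule *[OF order_refl refl]) auto
qed

text \<open>The module relation makes the reduced relation vanish on homogeneous \<open>v\<close>,
  hence everywhere by linearity; up to sign this is the weak relation. The other axioms carry over
  through the sign factor.\<close>

lemma weak_Lm_map_if_left_module:
  assumes "left_module scaleL GL m l scaleM GM k1 k"
    and f_Nil: "f [] = 0"
    and f: "\<And>xs. xs \<noteq> [] \<Longrightarrow> f xs = (\<lambda>v. scaleM (of_int ((-1) ^ (length xs - 1))) (k xs v))"
  shows "weak_Lm_map_to_End scaleL GL m l scaleM GM k1 f"
proof -
  interpret K: left_module scaleL GL m l scaleM GM k1 k by fact
  have ne: "xs \<noteq> []" if "1 \<le> length xs" for xs :: "'l list" using that by auto
  have lin: "Vector_Spaces.linear scaleM scaleM (k ys)" if "length ys \<le> n" "enat (Suc n) \<le> m" for ys n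
    using that by (intro K.k_linear[of "Suc (length ys)"]) (auto intro: order.trans[of _ "enat (Suc n)"])
  show ?thesis
  proof (intro weak_Lm_map.intro weak_Lm_map_axioms.intro Lm dg_lie_algebra_End dg)
    fix n assume n: "1 \<le> n" "enat n \<le> m - 1"
    show "multilinear scaleL (End_scale scaleM) n f"
      unfolding multilinear_def
    proof (intro allI impI)
      fix xs :: "'l list" and i assume xs: "length xs = n" "i < n"
      have ml: "Vector_Spaces.linear scaleL scaleM (\<lambda>x. k (xs[i := x]) v)" for v
        using K.k_multilinear[of "Suc n" v] n xs by (simp add: enat_le_minus_one_iff[OF m] multilinear_def)
      have "f (xs[i := x]) = (\<lambda>v. scaleM (of_int ((-1) ^ (n - 1))) (k (xs[i := x]) v))" for x
        using f[of "xs[i := x]"] xs by (cases "xs = []") auto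
      then show "Vector_Spaces.linear scaleL (End_scale scaleM) (\<lambda>x. f (xs[i := x]))"
        using ml unfolding Vector_Spaces.linear_iff
        by (auto simp: E.vector_space_axioms End_scale_def fun_eq_iff M.scale_right_distrib
            M.scale_left_commute simp del: of_int_power)
    qed
  next
    fix xs ds assume xs: "1 \<le> length xs" "enat (length xs) \<le> m - 1" "homogeneous GL ds xs"
    then have m': "enat (Suc (length xs)) \<le> m" by (simp add: enat_le_minus_one_iff[OF m])
    have "scaleM c (k xs v) \<in> GM (sum_list ds + int (length xs) - 1 + q)" if "v \<in> GM q" for v q c
      using K.k_degree[of "Suc (length xs)" xs ds v q] xs m' that
      by (intro M.subspace_scale[OF M.subspace_G]) (simp add: algebra_simps)
    then show "f xs \<in> End_grading scaleM GM (sum_list ds + int (length xs) - 1)"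
      unfolding f[OF ne[OF xs(1)]] End_grading_def
      using lin[OF order_refl m'] by (auto intro: MM.linear_compose_scale_right)
    fix \<sigma> assume \<sigma>: "\<sigma> permutes {..<length xs}"
    have "permute_list \<sigma> xs \<noteq> []" using ne[OF xs(1)] by (simp add: permute_list_eq_Nil_iff)
    then show "f (permute_list \<sigma> xs) = End_scale scaleM (of_int (chi \<sigma> ds)) (f xs)"
      using K.k_skew[of "Suc (length xs)" xs ds \<sigma>] xs m' \<sigma>
      by (simp add: f ne End_scale_def fun_eq_iff M.scale_left_commute del: of_int_power)
  next
    fix n and xs :: "'l list" and ds
    assume xs: "1 \<le> n" "enat n \<le> m - 1" "length xs = n" "homogeneous GL ds xs"
    then have m': "enat (Suc n) \<le> m" by (simp add: enat_le_minus_one_iff[OF m])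
    have ds: "length ds = n" using xs(3,4) by (simp add: homogeneous_def list_all2_lengthD)
    have red: "reduced_relation scaleM l k ds xs v = 0" for v
    proof (rule M.linear_eq_0_if_homogeneous[where \<phi> = "reduced_relation scaleM l k ds xs"])
      show "Vector_Spaces.linear scaleM scaleM (reduced_relation scaleM l k ds xs)"
        using lin[OF _ m'] xs(3) by (intro reduced_relation_linear M.vector_space_axioms) auto
      fix q v assume "v \<in> GM q"
      from K.k_relation[OF _ m' _ xs(4) this] show "reduced_relation scaleM l k ds xs v = 0"
        unfolding M.module_relation_eq_reduced_relation[OF xs(3) ds] using xs(3) by simp
    qed
    have "xs \<noteq> []" using xs by auto
    then show "End_diff scaleM k1 (sum_list ds + int n - 1) (f xs)
      + (\<Sum>(j, k) | 1 \<le> j \<and> 1 \<le> k \<and> j + k = n + 1. \<Sum>\<sigma>\<in>unshuffles k n.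
          End_scale scaleM (of_int (chi \<sigma> ds * (-1) ^ (k * (j - 1) + 1)))
            (f (l (args \<sigma> 0 k xs) # args \<sigma> k n xs)))
      + (\<Sum>(s, t) | 1 \<le> s \<and> 1 \<le> t \<and> s + t = n. \<Sum>\<tau>\<in>{\<tau> \<in> unshuffles s n. \<tau> 0 < \<tau> s}.
          End_scale scaleM (of_int (chi \<tau> ds * (-1) ^ (s - 1) *
              psgn ((int t - 1) * sum_list (args \<tau> 0 s ds))))
            (End_bracket scaleM (sum_list (args \<tau> 0 s ds) + int s - 1) (sum_list (args \<tau> s n ds) + int t - 1)
              (f (args \<tau> 0 s xs)) (f (args \<tau> s n xs)))) = 0"
      by (intro ext trans[OF M.weak_relation_eq_reduced_relation[where f = f and k = k and l = l,
            OF _ xs(3) ds f lin[OF _ m'], unfolded K.k_Nil]]) (simp_all add: red)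
  next
    fix xs :: "'l list" assume "\<not> (1 \<le> length xs \<and> enat (length xs) \<le> m - 1)"
    \<comment> \<open>The empty list lies outside the arities of \<open>f\<close> but not of
      \<open>k\<close>, hence the separate hypothesis \<open>f [] = 0\<close>.\<close>
    then show "f xs = 0"
      using K.k_outside[of xs] f_Nil f[of xs]
      by (cases "xs = []") (auto simp: enat_le_minus_one_iff[OF m] Suc_le_eq fun_eq_iff)
  qed
qed

text \<open>In arity one the module relation says that \<open>k1\<close> squares to zero; in higher
  arities it is the weak relation evaluated at \<open>v\<close>, up to an invertible sign. Linearity
  of each operator comes from \<open>weak_Lm_map_linear\<close>.\<close>

lemma left_module_if_weak_Lm_map:
  assumes "weak_Lm_map_to_End scaleL GL m l scaleM GM k1 f"
    and k_Nil: "k [] = k1"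
    and k: "\<And>xs. xs \<noteq> [] \<Longrightarrow> k xs = (\<lambda>v. scaleM (of_int ((-1) ^ (length xs - 1))) (f xs v))"
  shows "left_module scaleL GL m l scaleM GM k1 k"
proof -
  interpret F: weak_Lm_map scaleL GL m l "End_scale scaleM" "End_grading scaleM GM"
    "End_diff scaleM k1" "End_bracket scaleM" f by fact
  have f: "f xs = (\<lambda>v. scaleM (of_int ((-1) ^ (length xs - 1))) (k xs v))" if "xs \<noteq> []" for xs
    unfolding k[OF that] M.scale_scale of_int_sign_cancel M.scale_one ..
  have lin: "Vector_Spaces.linear scaleM scaleM (k ys)" if "enat (Suc (length ys)) \<le> m" for ys
  proof (cases "ys = []")
    case True
    then show ?thesis by (simp add: k_Nil M.d_linear)
  next
    case False
    then show ?thesis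
      unfolding k[OF False] using that
      by (intro MM.linear_compose_scale_right weak_Lm_map_linear assms(1))
        (auto simp: enat_le_minus_one_iff[OF m] Suc_le_eq)
  qed
  show ?thesis
  proof (intro left_module.intro left_module_axioms.intro Lm dg k_Nil)
    fix n v assume n: "1 \<le> n" "enat n \<le> m"
    show "multilinear scaleL scaleM (n - 1) (\<lambda>xs. k xs v)"
      unfolding multilinear_def
    proof (intro allI impI)
      fix xs :: "'l list" and i assume xs: "length xs = n - 1" "i < n - 1"
      have ml: "Vector_Spaces.linear scaleL (End_scale scaleM) (\<lambda>x. f (xs[i := x]))"
        using F.f_multilinear[of "n - 1"] n xs by (simp add: enat_le_minus_one_iff[OF m] multilinear_def)
      have "k (xs[i := x]) v = scaleM (of_int ((-1) ^ (n - 1 - 1))) (f (xs[i := x]) v)" for x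
        using k[of "xs[i := x]"] xs by (cases "xs = []") auto
      then show "Vector_Spaces.linear scaleL scaleM (\<lambda>x. k (xs[i := x]) v)"
        using ml unfolding Vector_Spaces.linear_iff
        by (auto simp: M.vector_space_axioms End_scale_def fun_eq_iff M.scale_right_distrib
            M.scale_left_commute simp del: of_int_power)
    qed
    fix xs :: "'l list" assume xs: "length xs = n - 1"
    then have m': "enat (Suc (length xs)) \<le> m" using n by simp
    show "Vector_Spaces.linear scaleM scaleM (k xs)" by (rule lin[OF m'])
    fix ds assume ds: "homogeneous GL ds xs"
    then have l: "length ds = length xs" by (simp add: homogeneous_def list_all2_lengthD)
    show "k xs v \<in> GM (sum_list ds + q + int n - 2)" if v: "v \<in> GM q" for q
    proof (cases "xs = []")
      case True
      then have "n = 1" "ds = []" using n xs l by auto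
      then show ?thesis using True M.d_degree[OF v] by (simp add: k_Nil)
    next
      case False
      then have "f xs \<in> End_grading scaleM GM (sum_list ds + int (length xs) - 1)"
        using F.f_degree[of xs ds] ds m' by (simp add: enat_le_minus_one_iff[OF m] Suc_le_eq)
      then have "f xs v \<in> GM (sum_list ds + int (length xs) - 1 + q)"
        using v by (simp add: End_grading_def)
      moreover have "sum_list ds + int (length xs) - 1 + q = sum_list ds + q + int n - 2"
        using xs n by simp
      ultimately show ?thesis
        unfolding k[OF False] by (intro M.subspace_scale[OF M.subspace_G]) simp
    qed
    show "k (permute_list \<sigma> xs) v = scaleM (of_int (chi \<sigma> ds)) (k xs v)" if \<sigma>: "\<sigma> permutes {..<n - 1}" for \<sigma>
    proof (cases "xs = []")
      case True
      then have "\<sigma> = id" using \<sigma> xs by simp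
      then show ?thesis using True by simp
    next
      case False
      moreover have "permute_list \<sigma> xs \<noteq> []" using False by (simp add: permute_list_eq_Nil_iff)
      moreover have "1 \<le> length xs" using False by (simp add: Suc_le_eq)
      ultimately show ?thesis
        using F.f_skew[of xs ds \<sigma>] \<sigma> xs[symmetric] m' ds
        by (simp add: k End_scale_def M.scale_left_commute enat_le_minus_one_iff[OF m] Suc_le_eq
            del: of_int_power)
    qed
    have "reduced_relation scaleM l k ds xs v = 0"
    proof (cases "xs = []")
      case True
      then show ?thesis using M.d_d l by (simp add: reduced_relation_def k_Nil)
    next
      case False
      have lin': "Vector_Spaces.linear scaleM scaleM (k ys)" if "length ys \<le> length xs" for ys
        using that m' by (intro lin) (auto intro: order.trans[of _ "enat (Suc (length xs))"])
      \<comment> \<open>The weak relation is an equality of functions, so it may be evaluated at any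
        \<open>v\<close>.\<close>
      have "scaleM (of_int ((-1) ^ (length xs + 1))) (reduced_relation scaleM l k ds xs v) = 0"
        using trans[OF M.weak_relation_eq_reduced_relation[where f = f and k = k and l = l and v = v,
              OF False refl l f lin', unfolded k_Nil, symmetric]
            fun_cong[OF F.f_relation[OF _ _ refl ds]]] False m'
        by (simp only: zero_fun_apply) (simp add: enat_le_minus_one_iff[OF m] Suc_le_eq)
      then show ?thesis by simp
    qed
    then show "(\<Sum>(i, j) | 1 \<le> i \<and> 1 \<le> j \<and> i + j = n + 1. \<Sum>\<sigma>\<in>unshuffles i n.
        scaleM (of_int (chi \<sigma> (ds @ [q]) * (-1) ^ (i * (j - 1))))
          (module_term scaleM l k i j \<sigma> (ds @ [q]) xs v)) = 0" for q
      using M.module_relation_eq_reduced_relation[OF refl l, of q l k v] n xs by simp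
  next
    fix xs :: "'l list" assume *: "\<not> enat (length xs + 1) \<le> m"
    \<comment> \<open>The differential \<open>k []\<close> has arity 1, which is within range
      because \<open>1 \<le> m\<close>.\<close>
    then have "xs \<noteq> []" using m by (auto simp: one_enat_def)
    moreover have "f xs = 0"
      using * by (intro F.f_outside) (simp add: enat_le_minus_one_iff[OF m])
    ultimately show "k xs = 0" by (simp add: k fun_eq_iff)
  qed
qed

end

theorem theorem5p4:
  fixes scaleL :: "'k::field_char_0 \<Rightarrow> 'l::ab_group_add \<Rightarrow> 'l" and GL :: "int \<Rightarrow> 'l set"
    and scaleM :: "'k \<Rightarrow> 'v::ab_group_add \<Rightarrow> 'v" and GM :: "int \<Rightarrow> 'v set"
    and m :: enat and l :: "'l list \<Rightarrow> 'l" and k1 :: "'v \<Rightarrow> 'v"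
  assumes "1 \<le> m"
    and "Lm_algebra scaleL GL m l"
    and "dg_vector_space scaleM GM k1"
  shows "\<exists>\<Phi>. bij_betw \<Phi>
        {k. left_module scaleL GL m l scaleM GM k1 k}
        {f. weak_Lm_map_to_End scaleL GL m l scaleM GM k1 f}
      \<and> (\<forall>k xs v. left_module scaleL GL m l scaleM GM k1 k \<longrightarrow> xs \<noteq> [] \<longrightarrow>
          \<Phi> k xs v = scaleM ((-1) ^ (length xs - 1)) (k xs v))"
proof -
  interpret M: dg_vector_space scaleM GM k1 by fact
  \<comment> \<open>Arity 0 is outside the range of a weak map, so the value at \<open>[]\<close>
    has to be 0.\<close>
  define \<Phi> where "\<Phi> k = (\<lambda>xs v. if xs = [] then 0
    else scaleM (of_int ((-1) ^ (length xs - 1))) (k xs v))" for k :: "'l list \<Rightarrow> 'v \<Rightarrow> 'v"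
  \<comment> \<open>The first structure map, lost under \<open>\<Phi>\<close>, is restored from the
    given differential.\<close>
  define \<Psi> where "\<Psi> f = (\<lambda>xs v. if xs = [] then k1 v
    else scaleM (of_int ((-1) ^ (length xs - 1))) (f xs v))" for f :: "'l list \<Rightarrow> 'v \<Rightarrow> 'v"
  have "bij_betw \<Phi> {k. left_module scaleL GL m l scaleM GM k1 k}
      {f. weak_Lm_map_to_End scaleL GL m l scaleM GM k1 f}"
  proof (rule bij_betw_byWitness[where f' = \<Psi>])
    show "\<forall>k\<in>{k. left_module scaleL GL m l scaleM GM k1 k}. \<Psi> (\<Phi> k) = k"
    proof safe
      fix k assume "left_module scaleL GL m l scaleM GM k1 k"
      then have "k [] = k1" by (rule left_module.k_Nil)
      then show "\<Psi> (\<Phi> k) = k"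
        by (auto simp: \<Phi>_def \<Psi>_def fun_eq_iff of_int_sign_cancel simp del: of_int_power)
    qed
    show "\<forall>f\<in>{f. weak_Lm_map_to_End scaleL GL m l scaleM GM k1 f}. \<Phi> (\<Psi> f) = f"
    proof safe
      fix f assume "weak_Lm_map_to_End scaleL GL m l scaleM GM k1 f"
      then have "f [] = 0" by (rule weak_Lm_map.f_outside) simp
      then show "\<Phi> (\<Psi> f) = f"
        by (auto simp: \<Phi>_def \<Psi>_def fun_eq_iff of_int_sign_cancel simp del: of_int_power)
    qed
    show "\<Phi> ` {k. left_module scaleL GL m l scaleM GM k1 k} \<subseteq>
        {f. weak_Lm_map_to_End scaleL GL m l scaleM GM k1 f}"
      by (auto intro!: weak_Lm_map_if_left_module[OF assms] simp: \<Phi>_def fun_eq_iff)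
    show "\<Psi> ` {f. weak_Lm_map_to_End scaleL GL m l scaleM GM k1 f} \<subseteq>
        {k. left_module scaleL GL m l scaleM GM k1 k}"
      by (auto intro!: left_module_if_weak_Lm_map[OF assms] simp: \<Psi>_def fun_eq_iff)
  qed
  then show ?thesis
    by (intro exI[of _ \<Phi>]) (simp add: \<Phi>_def)
qed

end
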